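(* Let $X$ be a finite abstract simplicial complex whose vertices carry a partial order that restricts to a total order on every face of $X$, and let $n \geq 1$ be an integer. Let $C(n,X)$ be the simplicial complex whose vertices are the minimal conf matrices for $X$ with $n$ rows, and where a collection of such matrices forms a face if their columns can be assembled into a single conf matrix. Then there is a homotopy equivalence $$|C(n,X)| \simeq \operatorname{Conf}(n,|X|).$$
   Context: For a topological space $Z$, the configuration space is $\operatorname{Conf}(n,Z)=\{(z_1,\ldots,z_n)\in Z^n : z_i\neq z_j \text{ whenever } i\neq j\}$, with the subspace topology from $Z^n$. $|X|$ denotes the geometric realization of an abstract simplicial complex $X$. If $X$ has vertex set $\{1,\ldots,k\}$, then $|X|$ is the set of $(\alpha_1,\ldots,\alpha_k)\in\mathbb{R}^k$ with all $\alpha_i\ge 0$, $\sum_i\alpha_i=1$, and $\{i:\alpha_i>0\}$ a face of $X$. Fix a partial order on the vertices of $X$ that restricts to a total order on every face. A conf matrix for $X$ with $n$ rows is a matrix $(v_{ij})$ with $n$ rows and at least one column (any finite number of columns), with entries vertices of $X$, such that (1) each row is weakly monotone increasing (from left to right) in the vertex ordering; (2) for every row, the set of vertices appearing within that row is a face of $X$; (3) no row is repeated, i.e. the $n$ rows are pairwise distinct. A conf matrix is minimal if deleting a column results in duplicate rows, no matter which column is deleted. Deleting the only column of a one-column matrix yields a matrix with no columns, which is not a conf matrix; a one-column conf matrix is regarded as minimal for every $n \geq 1$. A finite nonempty collection of minimal conf matrices with $n$ rows is a face of $C(n,X)$ when there is a conf matrix with $n$ rows whose set of columns is exactly the union of the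 sets of columns of the matrices in the collection. *)

theory Defs
  imports "HOL-Analysis.Analysis"
begin

section \<open>Configuration spaces\<close>

definition Conf :: "nat \<Rightarrow> 'a topology \<Rightarrow> (nat \<Rightarrow> 'a) topology" where
  "Conf n Z = subtopology (product_topology (\<lambda>_. Z) {..<n}) {z. inj_on z {..<n}}"

section \<open>Abstract simplicial complexes and their realizations\<close>

text \<open>A complex is given by its set of faces. The empty face is not listed, so the vertex set
  is \<open>\<Union>K\<close>, and every vertex is a face.\<close>

definition abstract_simplicial_complex :: "'v set set \<Rightarrow> bool" where
  "abstract_simplicial_complex K \<longleftrightarrow>
     (\<forall>\<sigma>\<in>K. finite \<sigma> \<and> \<sigma> \<noteq> {}) \<and> (\<forall>\<sigma>\<in>K. \<forall>\<tau>. \<tau> \<subseteq> \<sigma> \<and> \<tau> \<noteq> {} \<longrightarrow> \<tau> \<in> K)"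

text \<open>This is intended for finite complexes only: a subspace of the Euclidean space with one
  coordinate for each vertex.\<close>

definition geometric_realization :: "'v set set \<Rightarrow> ('v \<Rightarrow> real) topology" where
  "geometric_realization K =
     subtopology (powertop_real (\<Union>K))
       {\<alpha>. (\<forall>v\<in>\<Union>K. 0 \<le> \<alpha> v) \<and> (\<Sum>v\<in>\<Union>K. \<alpha> v) = 1 \<and> {v\<in>\<Union>K. 0 < \<alpha> v} \<in> K}"

definition facewise_linear_order :: "'v set set \<Rightarrow> 'v rel \<Rightarrow> bool" where
  "facewise_linear_order K r \<longleftrightarrow>
     partial_order_on (\<Union>K) r \<and> (\<forall>\<sigma>\<in>K. linear_order_on \<sigma> (Restr r \<sigma>))"

section \<open>Conf matrices\<close>

text \<open>A matrix is the list of its rows, all of the same length.\<close>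

definition conf_matrix :: "'v set set \<Rightarrow> 'v rel \<Rightarrow> nat \<Rightarrow> 'v list list \<Rightarrow> bool" where
  "conf_matrix X r n M \<longleftrightarrow>
     length M = n \<and> (\<exists>m\<ge>1. \<forall>\<rho>\<in>set M. length \<rho> = m) \<and>
     (\<forall>\<rho>\<in>set M. sorted_wrt (\<lambda>x y. (x, y) \<in> r) \<rho> \<and> set \<rho> \<in> X) \<and>
     distinct M"

definition delete_column :: "nat \<Rightarrow> 'v list list \<Rightarrow> 'v list list" where
  "delete_column j M = map (\<lambda>\<rho>. take j \<rho> @ drop (Suc j) \<rho>) M"

text \<open>The first disjunct makes every one-column conf matrix minimal; it only matters when
  there is a single row, as deleting the only column of two or more rows leaves equal rows.\<close>

definition minimal_conf_matrix :: "'v set set \<Rightarrow> 'v rel \<Rightarrow> nat \<Rightarrow> 'v list list \<Rightarrow> bool" where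
  "minimal_conf_matrix X r n M \<longleftrightarrow>
     conf_matrix X r n M \<and>
     (length (List.transpose M) = 1 \<or>
      (\<forall>j < length (List.transpose M). \<not> distinct (delete_column j M)))"

definition conf_complex :: "nat \<Rightarrow> 'v set set \<Rightarrow> 'v rel \<Rightarrow> 'v list list set set" where
  "conf_complex n X r =
     {S. finite S \<and> S \<noteq> {} \<and> (\<forall>M\<in>S. minimal_conf_matrix X r n M) \<and>
         (\<exists>A. conf_matrix X r n A \<and>
              set (List.transpose A) = (\<Union>M\<in>S. set (List.transpose M)))}"

section \<open>The complex is well defined\<close>

lemma conf_matrix_columns:
  assumes "conf_matrix X r n M" and "1 \<le> n"
  obtains m where "1 \<le> m" "length M = n" "\<And>i. i < n \<Longrightarrow> length (M ! i) = m"
    "List.transpose M = map (\<lambda>j. map (\<lambda>i. M ! i ! j) [0..<n]) [0..<m]"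
proof -
  from assms(1) obtain m where m: "1 \<le> m" "\<forall>\<rho>\<in>set M. length \<rho> = m" and l: "length M = n"
    by (auto simp: conf_matrix_def)
  have 1: "length (M ! i) = m" if "i < n" for i
    using that m l by auto
  have "M \<noteq> []" using l assms(2) by auto
  then have "List.transpose M = map (\<lambda>j. map (\<lambda>i. M ! i ! j) [0..<n]) [0..<m]"
    using transpose_rectangle[of M m] 1 l by auto
  with m l 1 show ?thesis using that by blast
qed

lemma Union_conf_complex:
  "\<Union>(conf_complex n X r) = {M. minimal_conf_matrix X r n M}"
proof -
  have "{M} \<in> conf_complex n X r" if "minimal_conf_matrix X r n M" for M
    using that by (auto simp: conf_complex_def minimal_conf_matrix_def)
  then have "{M. minimal_conf_matrix X r n M} \<subseteq> \<Union>(conf_complex n X r)" by blast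
  then show ?thesis by (auto simp: conf_complex_def)
qed

lemma minimal_conf_matrix_columns_le:
  assumes M: "minimal_conf_matrix X r n M" and n: "1 \<le> n"
  shows "length (List.transpose M) \<le> n * n + 1"
proof (cases "length (List.transpose M) = 1")
  case False
  from M have cM: "conf_matrix X r n M" by (simp add: minimal_conf_matrix_def)
  then obtain m where m: "length M = n" "\<And>i. i < n \<Longrightarrow> length (M ! i) = m"
    "List.transpose M = map (\<lambda>j. map (\<lambda>i. M ! i ! j) [0..<n]) [0..<m]"
    using conf_matrix_columns n by metis
  from m(3) have lt: "length (List.transpose M) = m" by simp
  have d: "distinct M" using cM by (simp add: conf_matrix_def)
  have "\<exists>p. fst p < n \<and> snd p < n \<and> fst p \<noteq> snd p \<and>
          (\<forall>k<m. k \<noteq> j \<longrightarrow> M ! fst p ! k = M ! snd p ! k)" if j: "j < m" for j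
  proof -
    have "\<not> distinct (delete_column j M)"
      using M False lt j by (auto simp: minimal_conf_matrix_def)
    then obtain a b where ab: "a < n" "b < n" "a \<noteq> b"
      and e: "take j (M ! a) @ drop (Suc j) (M ! a) = take j (M ! b) @ drop (Suc j) (M ! b)"
      by (auto simp: distinct_conv_nth delete_column_def m(1))
    from e m(2) ab have t: "take j (M ! a) = take j (M ! b)"
      and dr: "drop (Suc j) (M ! a) = drop (Suc j) (M ! b)"
      by (auto simp: append_eq_append_conv)
    have "M ! a ! k = M ! b ! k" if "k < m" "k \<noteq> j" for k
    proof (cases "k < j")
      case True
      then show ?thesis using t by (metis nth_take)
    next
      case False
      with that have k: "k = Suc j + (k - Suc j)" by simp
      show ?thesis
        using dr m(2)[of a] m(2)[of b] ab j by (metis Suc_leI k nth_drop)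
    qed
    with ab show ?thesis by (intro exI[of _ "(a, b)"]) auto
  qed
  then obtain f where f: "\<And>j. j < m \<Longrightarrow> fst (f j) < n \<and> snd (f j) < n \<and> fst (f j) \<noteq> snd (f j) \<and>
          (\<forall>k<m. k \<noteq> j \<longrightarrow> M ! fst (f j) ! k = M ! snd (f j) ! k)"
    by metis
  have "inj_on f {..<m}"
  proof (rule inj_onI, rule ccontr)
    fix i j assume ij: "i \<in> {..<m}" "j \<in> {..<m}" "f i = f j" "i \<noteq> j"
    then have "\<forall>k<m. M ! fst (f i) ! k = M ! snd (f i) ! k"
      using f by (metis lessThan_iff)
    with f[of i] ij(1) m have "M ! fst (f i) = M ! snd (f i)"
      by (intro nth_equalityI) auto
    with f[of i] ij(1) d m(1) show False by (auto simp: nth_eq_iff_index_eq)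
  qed
  moreover have "f ` {..<m} \<subseteq> {..<n} \<times> {..<n}"
  proof
    fix p assume "p \<in> f ` {..<m}"
    then obtain j where "j < m" "p = f j" by auto
    with f[of j] show "p \<in> {..<n} \<times> {..<n}" by (simp add: mem_Times_iff)
  qed
  ultimately have "card {..<m} \<le> card ({..<n} \<times> {..<n})"
    by (rule card_inj_on_le) simp
  then show ?thesis using lt by (simp add: card_cartesian_product)
qed simp

lemma finite_conf_complex:
  assumes "abstract_simplicial_complex X" "finite X" "1 \<le> n"
  shows "finite (conf_complex n X r)"
proof -
  have V: "finite (\<Union>X)" using assms by (auto simp: abstract_simplicial_complex_def)
  let ?R = "{\<rho>. set \<rho> \<subseteq> \<Union>X \<and> length \<rho> \<le> n * n + 1}"
  have "M \<in> {M. set M \<subseteq> ?R \<and> length M = n}" if M: "minimal_conf_matrix X r n M" for M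
  proof -
    have cM: "conf_matrix X r n M" using M by (simp add: minimal_conf_matrix_def)
    then obtain m where m: "length M = n" "\<And>i. i < n \<Longrightarrow> length (M ! i) = m"
      "List.transpose M = map (\<lambda>j. map (\<lambda>i. M ! i ! j) [0..<n]) [0..<m]"
      using conf_matrix_columns assms(3) by metis
    have "m \<le> n * n + 1"
      using minimal_conf_matrix_columns_le[OF M assms(3)] m(3) by simp
    moreover have "length \<rho> = m" if "\<rho> \<in> set M" for \<rho>
      using that m(1,2) by (metis in_set_conv_nth)
    moreover have "set \<rho> \<subseteq> \<Union>X" if "\<rho> \<in> set M" for \<rho>
      using that cM unfolding conf_matrix_def by blast
    ultimately show ?thesis using m(1) by auto
  qed
  then have "{M. minimal_conf_matrix X r n M} \<subseteq> {M. set M \<subseteq> ?R \<and> length M = n}" by blast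
  moreover have "finite {M. set M \<subseteq> ?R \<and> length M = n}"
    using V by (intro finite_lists_length_eq finite_lists_length_le)
  ultimately have "finite {M. minimal_conf_matrix X r n M}" by (rule finite_subset)
  moreover have "conf_complex n X r \<subseteq> Pow {M. minimal_conf_matrix X r n M}"
    by (auto simp: conf_complex_def)
  ultimately show ?thesis by (meson finite_Pow_iff finite_subset)
qed

lemma abstract_simplicial_complex_conf_complex:
  assumes X: "abstract_simplicial_complex X" and n: "1 \<le> n"
  shows "abstract_simplicial_complex (conf_complex n X r)"
proof -
  have "T \<in> conf_complex n X r"
    if S: "S \<in> conf_complex n X r" and T: "T \<subseteq> S" "T \<noteq> {}" for S T
  proof -
    from S obtain A where A: "conf_matrix X r n A"
      and cols: "set (List.transpose A) = (\<Union>M\<in>S. set (List.transpose M))"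
      and mins: "\<forall>M\<in>S. minimal_conf_matrix X r n M" and fin: "finite S"
      by (auto simp: conf_complex_def)
    obtain m where m: "length A = n" "\<And>i. i < n \<Longrightarrow> length (A ! i) = m"
      "List.transpose A = map (\<lambda>j. map (\<lambda>i. A ! i ! j) [0..<n]) [0..<m]"
      using conf_matrix_columns A n by metis
    define col where "col = (\<lambda>j. map (\<lambda>i. A ! i ! j) [0..<n])"
    define U where "U = (\<Union>M\<in>T. set (List.transpose M))"
    define J where "J = filter (\<lambda>j. col j \<in> U) [0..<m]"
    define B where "B = map (\<lambda>\<rho>. map ((!) \<rho>) J) A"
    have J: "set J = {j. j < m \<and> col j \<in> U}" "sorted_wrt (<) J"
      by (auto simp: J_def sorted_wrt_filter)
    have "U \<subseteq> col ` {..<m}"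
      using cols T(1) by (auto simp: U_def m(3) col_def atLeast0LessThan)
    then have colJ: "col ` set J = U" using J by auto
    obtain M where M: "M \<in> T" using T(2) by blast
    then have cM: "conf_matrix X r n M" using mins T(1) by (auto simp: minimal_conf_matrix_def)
    then obtain l where l: "1 \<le> l" "length M = n" "\<And>i. i < n \<Longrightarrow> length (M ! i) = l"
      "List.transpose M = map (\<lambda>j. map (\<lambda>i. M ! i ! j) [0..<n]) [0..<l]"
      using conf_matrix_columns n by metis
    have MU: "map (\<lambda>i. M ! i ! k) [0..<n] \<in> U" if "k < l" for k
      using M that unfolding U_def by (intro UN_I[of M]) (auto simp: l(4))
    have JN: "J \<noteq> []" using MU[of 0] l(1) colJ by force
    have B_nth: "B ! i = map ((!) (A ! i)) J" if "i < n" for i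
      using that m(1) by (simp add: B_def)
    have lB: "length B = n" by (simp add: B_def m(1))
    have "distinct B"
    proof (rule ccontr)
      assume "\<not> distinct B"
      then obtain a b where ab: "a < n" "b < n" "a \<noteq> b" "B ! a = B ! b"
        by (auto simp: distinct_conv_nth lB)
      then have eq: "A ! a ! j = A ! b ! j" if "j \<in> set J" for j
        using that by (simp add: B_nth)
      have "M ! a ! k = M ! b ! k" if k: "k < l" for k
      proof -
        obtain j where j: "j \<in> set J" "map (\<lambda>i. M ! i ! k) [0..<n] = col j"
          using MU[OF k] colJ by (metis imageE)
        then have "M ! i ! k = A ! i ! j" if "i < n" for i
          using that by (auto simp: col_def)
        with ab eq[OF j(1)] show ?thesis by simp
      qed
      then have "M ! a = M ! b" using l(3) ab by (intro nth_equalityI) auto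
      with ab l(2) cM show False by (auto simp: conf_matrix_def nth_eq_iff_index_eq)
    qed
    moreover have "sorted_wrt (\<lambda>x y. (x, y) \<in> r) (map ((!) \<rho>) J) \<and> set (map ((!) \<rho>) J) \<in> X"
      if \<rho>: "\<rho> \<in> set A" for \<rho>
    proof -
      have s: "sorted_wrt (\<lambda>x y. (x, y) \<in> r) \<rho>" and f: "set \<rho> \<in> X"
        using A \<rho> by (simp_all add: conf_matrix_def)
      have len: "length \<rho> = m"
        using \<rho> m(1,2) by (metis in_set_conv_nth)
      have "sorted_wrt (\<lambda>x y. (\<rho> ! x, \<rho> ! y) \<in> r) J"
      proof (rule sorted_wrt_mono_rel[OF _ J(2)])
        fix x y assume "x \<in> set J" "y \<in> set J" "x < y"
        then show "(\<rho> ! x, \<rho> ! y) \<in> r"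
          using sorted_wrt_nth_less[OF s, of x y] len J(1) by simp
      qed
      moreover have "set (map ((!) \<rho>) J) \<subseteq> set \<rho>"
      proof
        fix v assume "v \<in> set (map ((!) \<rho>) J)"
        then obtain j where "j \<in> set J" "v = \<rho> ! j" by auto
        with J(1) len show "v \<in> set \<rho>" by simp
      qed
      moreover have "set (map ((!) \<rho>) J) \<noteq> {}" using JN by simp
      ultimately show ?thesis
        using f X unfolding sorted_wrt_map abstract_simplicial_complex_def by blast
    qed
    moreover have "\<exists>k\<ge>1. \<forall>\<rho>\<in>set B. length \<rho> = k"
      using JN by (intro exI[of _ "length J"]) (auto simp: B_def Suc_le_eq)
    ultimately have cB: "conf_matrix X r n B"
      unfolding conf_matrix_def using lB by (simp add: B_def)
    have "List.transpose B = map (\<lambda>k. map (\<lambda>i. B ! i ! k) [0..<n]) [0..<length J]"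
      using transpose_rectangle[of B "length J"] lB n B_nth by force
    also have "\<dots> = map col J"
      by (rule nth_equalityI) (auto simp: B_nth col_def)
    finally have "set (List.transpose B) = U" using colJ by simp
    with cB T fin mins show ?thesis
      by (auto simp: conf_complex_def U_def intro: finite_subset)
  qed
  moreover have "finite S \<and> S \<noteq> {}" if "S \<in> conf_complex n X r" for S
    using that by (simp add: conf_complex_def)
  ultimately show ?thesis unfolding abstract_simplicial_complex_def by blast
qed

end

theory Submission
  imports Defs
begin

text \<open>
  A point of the realization of \<open>X\<close> is a probability vector supported on a totally ordered face, so it
  cuts the unit interval into consecutive cells, one for each vertex of that face, the length of a cell
  being the weight of its vertex. Superimposing the partitions of \<open>n\<close> points gives a common
  refinement whose pieces are labelled by columns of vertices. From left to right these columns form a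
  matrix with monotone rows on faces, and the lengths of the pieces are weights on the columns. This
  is the usual triangulation of a product of ordered complexes. Two of the \<open>n\<close> points coincide
  exactly when the two corresponding rows do, so the configurations are the weighted column sets
  of conf matrices: the configuration space is homeomorphic to the set of probability vectors on
  columns whose support is the column set of a conf matrix
  (\<open>realization_column_sets_homeomorphic_Conf\<close>). One direction of the homeomorphism takes marginals,
  the other takes lengths of common cells.

  The column sets of conf matrices are closed under enlargement inside larger ones, and each contains
  the column set of a minimal conf matrix. Hence the space of weighted column sets is covered by the
  open stars of the minimal ones. An intersection of such stars is again an open star, of the union of
  their column sets, or is empty, so \<open>C(n, X)\<close> is the nerve of a cover with contractible
  intersections. The nerve theorem is proved here with explicit maps
  (\<open>subset_nerve_homotopy_equivalent\<close>): a vertex of the nerve goes to the barycentre of its column set,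
  and a weighted column set goes to the normalized products of the weights over the minimal column sets.
  For both composites, the support of a point and the support of its image are nested, so a straight
  line joins the composite to the identity (\<open>straight_line_homotopic\<close>).
\<close>

section \<open>Maps into realizations and configuration spaces\<close>

definition support :: "'v set set \<Rightarrow> ('v \<Rightarrow> real) \<Rightarrow> 'v set" where
  "support K \<alpha> = {v\<in>\<Union>K. 0 < \<alpha> v}"

lemma support_iff: "v \<in> support K \<alpha> \<longleftrightarrow> v \<in> \<Union>K \<and> 0 < \<alpha> v"
  by (simp only: support_def mem_Collect_eq)

lemma topspace_geometric_realization:
  "\<alpha> \<in> topspace (geometric_realization K) \<longleftrightarrow>
     \<alpha> \<in> extensional (\<Union>K) \<and> (\<forall>v\<in>\<Union>K. 0 \<le> \<alpha> v) \<and> (\<Sum>v\<in>\<Union>K. \<alpha> v) = 1 \<and> support K \<alpha> \<in> K"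
  by (auto simp: geometric_realization_def support_def PiE_def)

lemma realization_nonneg: "\<alpha> \<in> topspace (geometric_realization K) \<Longrightarrow> v \<in> \<Union>K \<Longrightarrow> 0 \<le> \<alpha> v"
  unfolding topspace_geometric_realization by blast

lemma realization_sum: "\<alpha> \<in> topspace (geometric_realization K) \<Longrightarrow> (\<Sum>v\<in>\<Union>K. \<alpha> v) = 1"
  unfolding topspace_geometric_realization by blast

lemma realization_support: "\<alpha> \<in> topspace (geometric_realization K) \<Longrightarrow> support K \<alpha> \<in> K"
  unfolding topspace_geometric_realization by blast

lemma realization_extensional: "\<alpha> \<in> topspace (geometric_realization K) \<Longrightarrow> \<alpha> \<in> extensional (\<Union>K)"
  unfolding topspace_geometric_realization by blast

lemma continuous_map_realization_coordinate:
  "v \<in> \<Union>K \<Longrightarrow> continuous_map (geometric_realization K) euclideanreal (\<lambda>\<alpha>. \<alpha> v)"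
  unfolding geometric_realization_def
  by (intro continuous_map_from_subtopology continuous_map_product_projection)

lemma continuous_map_into_realization:
  assumes "\<And>v. v \<in> \<Union>K \<Longrightarrow> continuous_map Y euclideanreal (\<lambda>y. f y v)"
    and "\<And>y. y \<in> topspace Y \<Longrightarrow> f y \<in> topspace (geometric_realization K)"
  shows "continuous_map Y (geometric_realization K) f"
  unfolding geometric_realization_def
proof (rule continuous_map_into_subtopology)
  show "continuous_map Y (powertop_real (\<Union>K)) f"
    using assms by (auto simp: continuous_map_componentwise topspace_geometric_realization)
  show "f \<in> topspace Y \<rightarrow> {\<alpha>. (\<forall>v\<in>\<Union>K. 0 \<le> \<alpha> v) \<and> (\<Sum>v\<in>\<Union>K. \<alpha> v) = 1 \<and> {v\<in>\<Union>K. 0 < \<alpha> v} \<in> K}"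
    using assms(2) by (auto simp: topspace_geometric_realization support_def)
qed

lemma support_convex_combination:
  assumes "\<And>v. v \<in> \<Union>K \<Longrightarrow> 0 \<le> \<alpha> v" "\<And>v. v \<in> \<Union>K \<Longrightarrow> 0 \<le> \<beta> v" "0 < t" "t < 1"
  shows "support K (\<lambda>v\<in>\<Union>K. (1 - t) * \<alpha> v + t * \<beta> v) = support K \<alpha> \<union> support K \<beta>"
proof -
  have "0 < (1 - t) * \<alpha> v + t * \<beta> v \<longleftrightarrow> 0 < \<alpha> v \<or> 0 < \<beta> v" if "v \<in> \<Union>K" for v
  proof
    assume p: "0 < (1 - t) * \<alpha> v + t * \<beta> v"
    show "0 < \<alpha> v \<or> 0 < \<beta> v"
    proof (rule ccontr)
      assume "\<not> (0 < \<alpha> v \<or> 0 < \<beta> v)"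
      then have "\<alpha> v = 0" "\<beta> v = 0" using assms(1,2)[OF that] by auto
      then show False using p by simp
    qed
  next
    assume "0 < \<alpha> v \<or> 0 < \<beta> v"
    then show "0 < (1 - t) * \<alpha> v + t * \<beta> v"
      using assms(1,2)[OF that] assms(3,4)
      by (auto intro: add_pos_nonneg add_nonneg_pos)
  qed
  then show ?thesis by (auto simp: support_def)
qed

text \<open>Strictly between the two ends, the support of a point on the segment from \<open>f y\<close> to \<open>g y\<close> is the
  union of the supports at the ends. The segment therefore stays in the realization as soon as this
  union is a member of \<open>K\<close>, also for a family \<open>K\<close> that is not a complex, such as the column sets of
  conf matrices.\<close>
lemma straight_line_homotopic:
  assumes f: "continuous_map Y (geometric_realization K) f"
    and g: "continuous_map Y (geometric_realization K) g"
    and K: "\<And>y. y \<in> topspace Y \<Longrightarrow> support K (f y) \<union> support K (g y) \<in> K"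
  shows "homotopic_with (\<lambda>_. True) Y (geometric_realization K) f g"
proof -
  let ?h = "\<lambda>p. \<lambda>v\<in>\<Union>K. (1 - fst p) * f (snd p) v + fst p * g (snd p) v"
  let ?T = "prod_topology (top_of_set {0..1::real}) Y"
  have fg: "f y \<in> topspace (geometric_realization K)" "g y \<in> topspace (geometric_realization K)"
    if "y \<in> topspace Y" for y
    using that f g continuous_map_image_subset_topspace by blast+
  have h0: "?h (0, y) = f y" and h1: "?h (1, y) = g y" if "y \<in> topspace Y" for y
    using fg[OF that] by (simp_all add: topspace_geometric_realization extensional_restrict)
  have coord: "continuous_map ?T euclideanreal (\<lambda>p. k (snd p) v)"
    if "continuous_map Y (geometric_realization K) k" "v \<in> \<Union>K" for k v
  proof -
    have "continuous_map Y euclideanreal ((\<lambda>\<alpha>. \<alpha> v) \<circ> k)"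
      by (rule continuous_map_compose[OF that(1) continuous_map_realization_coordinate[OF that(2)]])
    then have "continuous_map ?T euclideanreal ((\<lambda>\<alpha>. \<alpha> v) \<circ> k \<circ> snd)"
      by (rule continuous_map_compose[OF continuous_map_snd])
    then show ?thesis by (simp add: o_def)
  qed
  have time: "continuous_map ?T euclideanreal fst"
    using continuous_map_fst[of "top_of_set {0..1::real}" Y] continuous_map_into_fulltopology by blast
  have "continuous_map ?T (geometric_realization K) ?h"
  proof (rule continuous_map_into_realization)
    fix v assume v: "v \<in> \<Union>K"
    then have "continuous_map ?T euclideanreal (\<lambda>p. (1 - fst p) * f (snd p) v + fst p * g (snd p) v)"
      using time coord[OF f v] coord[OF g v]
      by (intro continuous_map_add continuous_map_real_mult continuous_map_diff) auto
    then show "continuous_map ?T euclideanreal (\<lambda>p. ?h p v)" using v by simp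
  next
    fix p assume "p \<in> topspace ?T"
    then obtain t y where p: "p = (t, y)" "0 \<le> t" "t \<le> 1" "y \<in> topspace Y" by (cases p) auto
    consider "t = 0" | "t = 1" | "0 < t" "t < 1" using p by linarith
    then show "?h p \<in> topspace (geometric_realization K)"
    proof cases
      case 1
      then show ?thesis using fg(1)[OF p(4)] h0[OF p(4)] p(1) by simp
    next
      case 2
      then show ?thesis using fg(2)[OF p(4)] h1[OF p(4)] p(1) by simp
    next
      case 3
      have "support K (?h p) = support K (f y) \<union> support K (g y)"
        unfolding p(1) fst_conv snd_conv
        by (rule support_convex_combination)
          (use realization_nonneg[OF fg(1)[OF p(4)]] realization_nonneg[OF fg(2)[OF p(4)]] 3 in blast)+
      then have "support K (?h p) \<in> K" using K[OF p(4)] by simp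
      moreover have "(\<Sum>v\<in>\<Union>K. ?h p v) = 1"
      proof -
        have "(\<Sum>v\<in>\<Union>K. ?h p v) = (1 - t) * (\<Sum>v\<in>\<Union>K. f y v) + t * (\<Sum>v\<in>\<Union>K. g y v)"
          unfolding sum_distrib_left sum.distrib[symmetric] by (rule sum.cong) (auto simp: p(1))
        then show ?thesis using fg[OF p(4)] by (simp add: topspace_geometric_realization)
      qed
      ultimately show ?thesis
        using fg[OF p(4)] 3 by (auto simp: topspace_geometric_realization p(1))
    qed
  qed
  moreover have "\<forall>x\<in>topspace Y. ?h (0, x) = f x" "\<forall>x\<in>topspace Y. ?h (1, x) = g x"
    using h0 h1 by blast+
  ultimately show ?thesis
    by (subst homotopic_with) (auto intro!: exI[of _ ?h])
qed

lemma topspace_Conf: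
  "z \<in> topspace (Conf n Z) \<longleftrightarrow>
     z \<in> extensional {..<n} \<and> (\<forall>i<n. z i \<in> topspace Z) \<and> inj_on z {..<n}"
  by (auto simp: Conf_def PiE_def)

lemma continuous_map_Conf_coordinate:
  "i < n \<Longrightarrow> continuous_map (Conf n Z) Z (\<lambda>z. z i)"
  unfolding Conf_def by (intro continuous_map_from_subtopology continuous_map_product_projection) auto

lemma continuous_map_into_Conf:
  assumes "\<And>i. i < n \<Longrightarrow> continuous_map Y Z (\<lambda>y. f y i)"
    and "\<And>y. y \<in> topspace Y \<Longrightarrow> f y \<in> topspace (Conf n Z)"
  shows "continuous_map Y (Conf n Z) f"
  unfolding Conf_def
proof (rule continuous_map_into_subtopology)
  show "continuous_map Y (product_topology (\<lambda>_. Z) {..<n}) f"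
    using assms by (auto simp: continuous_map_componentwise topspace_Conf)
  show "f \<in> topspace Y \<rightarrow> {z. inj_on z {..<n}}"
    using assms(2) by (auto simp: topspace_Conf)
qed

text \<open>Continuity of the weights rests on this and on the analogous fact about minima.\<close>
lemma continuous_map_Max:
  assumes "finite I" "I \<noteq> {}" "\<And>i. i \<in> I \<Longrightarrow> continuous_map Y euclideanreal (\<lambda>y. f y i)"
  shows "continuous_map Y euclideanreal (\<lambda>y. Max (f y ` I))"
  using assms by (induction I rule: finite_ne_induct) (auto intro!: continuous_map_real_max)

lemma continuous_map_Min:
  assumes "finite I" "I \<noteq> {}" "\<And>i. i \<in> I \<Longrightarrow> continuous_map Y euclideanreal (\<lambda>y. f y i)"
  shows "continuous_map Y euclideanreal (\<lambda>y. Min (f y ` I))"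
  using assms by (induction I rule: finite_ne_induct) (auto intro!: continuous_map_real_min)

section \<open>A nerve theorem\<close>

text \<open>In the realization of \<open>Q\<close>, the points whose support contains \<open>\<sigma> i\<close> form the open star of
  \<open>\<sigma> i\<close>. For \<open>Q\<close> as in the next theorem, this is the nerve of the cover by these stars.\<close>

definition subset_nerve :: "'i set \<Rightarrow> ('i \<Rightarrow> 'c set) \<Rightarrow> 'c set set \<Rightarrow> 'i set set" where
  "subset_nerve I \<sigma> Q = {S. S \<subseteq> I \<and> S \<noteq> {} \<and> (\<Union>i\<in>S. \<sigma> i) \<in> Q}"

text \<open>The map \<open>f\<close> is affine and sends the vertex \<open>i\<close> to the barycentre of \<open>\<sigma> i\<close>. The map \<open>g\<close>
  normalizes functions \<open>\<phi>\<close> that are positive exactly on the open stars; some \<open>\<sigma> i\<close> lies in the support of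
  \<open>w\<close>, so their sum does not vanish, and convexity of \<open>Q\<close> makes the support of \<open>g w\<close> a member of the
  nerve. The support of \<open>f \<alpha>\<close> is the union of the \<open>\<sigma> i\<close> with \<open>i\<close> in the support of \<open>\<alpha>\<close>, while the support of \<open>g w\<close> consists of the \<open>i\<close> with
  \<open>\<sigma> i\<close> inside the support of \<open>w\<close>. This is a Galois connection between supports, so \<open>g \<circ> f\<close> enlarges
  supports, \<open>f \<circ> g\<close> shrinks them, and both are joined to the identity by straight lines.\<close>
theorem subset_nerve_homotopy_equivalent:
  fixes \<sigma> :: "'i \<Rightarrow> 'c set"
  assumes fin: "finite I" "finite (\<Union>Q)" and ne: "{} \<notin> Q"
    and \<sigma>: "\<And>i. i \<in> I \<Longrightarrow> \<sigma> i \<in> Q"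
    and cofinal: "\<And>T. T \<in> Q \<Longrightarrow> \<exists>i\<in>I. \<sigma> i \<subseteq> T"
    and convex: "\<And>A B D. A \<in> Q \<Longrightarrow> D \<in> Q \<Longrightarrow> A \<subseteq> B \<Longrightarrow> B \<subseteq> D \<Longrightarrow> B \<in> Q"
  shows "geometric_realization (subset_nerve I \<sigma> Q) homotopy_equivalent_space geometric_realization Q"
proof -
  let ?C = "subset_nerve I \<sigma> Q"
  let ?GC = "geometric_realization ?C" and ?GQ = "geometric_realization Q"
  have UC: "\<Union>?C = I"
  proof
    show "I \<subseteq> \<Union>?C"
    proof
      fix i assume "i \<in> I"
      then have "{i} \<in> ?C" using \<sigma> by (auto simp: subset_nerve_def)
      then show "i \<in> \<Union>?C" by blast
    qed
  qed (auto simp: subset_nerve_def)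
  have \<sigma>_sub: "\<sigma> i \<subseteq> \<Union>Q" if "i \<in> I" for i using \<sigma>[OF that] by blast
  have \<sigma>_fin: "finite (\<sigma> i)" if "i \<in> I" for i using \<sigma>_sub[OF that] fin(2) finite_subset by blast
  have \<sigma>_card: "0 < card (\<sigma> i)" if "i \<in> I" for i
    using \<sigma>[OF that] \<sigma>_fin[OF that] ne by (metis card_gt_0_iff)
  define bary where "bary i v = (if v \<in> \<sigma> i then 1 / real (card (\<sigma> i)) else 0)" for i v
  have bary_sum: "(\<Sum>v\<in>\<Union>Q. bary i v) = 1" if "i \<in> I" for i
  proof -
    have "(\<Sum>v\<in>\<Union>Q. bary i v) = (\<Sum>v\<in>\<sigma> i. 1 / real (card (\<sigma> i)))"
      unfolding bary_def using \<sigma>_sub[OF that] fin(2)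
      by (simp add: sum.If_cases Int_absorb1 Int_def[symmetric])
    then show ?thesis using \<sigma>_card[OF that] by simp
  qed
  define f where "f \<alpha> = (\<lambda>v\<in>\<Union>Q. (\<Sum>i\<in>I. \<alpha> i * bary i v))" for \<alpha> :: "'i \<Rightarrow> real"
  \<comment> \<open>The product is positive exactly on the open star of \<open>\<sigma> i\<close>.\<close>
  define \<phi> where "\<phi> w i = (\<Prod>v\<in>\<sigma> i. w v)" for w :: "'c \<Rightarrow> real" and i
  define g where "g w = (\<lambda>i\<in>I. \<phi> w i / (\<Sum>j\<in>I. \<phi> w j))" for w :: "'c \<Rightarrow> real"
  have supp_f: "support Q (f \<alpha>) = (\<Union>i\<in>support ?C \<alpha>. \<sigma> i)" if "\<And>i. i \<in> I \<Longrightarrow> 0 \<le> \<alpha> i" for \<alpha>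
  proof -
    have b: "0 \<le> bary i v" for i v by (simp add: bary_def)
    have p: "0 < \<alpha> i * bary i v \<longleftrightarrow> 0 < \<alpha> i \<and> v \<in> \<sigma> i" if "i \<in> I" for i v
      using \<sigma>_card[OF that] by (auto simp: bary_def zero_less_mult_iff)
    have "0 < (\<Sum>i\<in>I. \<alpha> i * bary i v) \<longleftrightarrow> (\<exists>i\<in>I. 0 < \<alpha> i * bary i v)" for v
    proof -
      have "0 \<le> \<alpha> i * bary i v" if "i \<in> I" for i
        using \<open>\<And>i. i \<in> I \<Longrightarrow> 0 \<le> \<alpha> i\<close>[OF that] b by simp
      then show ?thesis
        using fin(1) by (metis (no_types, lifting) less_eq_real_def order_less_irrefl sum_nonneg sum_nonneg_eq_0_iff)
    qed
    then have eq: "0 < (\<Sum>i\<in>I. \<alpha> i * bary i v) \<longleftrightarrow> (\<exists>i\<in>I. 0 < \<alpha> i \<and> v \<in> \<sigma> i)" for v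
      using p by auto
    show ?thesis
    proof (intro set_eqI iffI)
      fix v assume "v \<in> support Q (f \<alpha>)"
      then have "0 < (\<Sum>i\<in>I. \<alpha> i * bary i v)"
        unfolding support_def f_def mem_Collect_eq by (metis restrict_apply')
      then show "v \<in> (\<Union>i\<in>support ?C \<alpha>. \<sigma> i)"
        using eq[of v] by (auto simp: support_def UC)
    next
      fix v assume "v \<in> (\<Union>i\<in>support ?C \<alpha>. \<sigma> i)"
      then obtain i where i: "i \<in> I" "0 < \<alpha> i" "v \<in> \<sigma> i" by (auto simp: support_def UC)
      then have "v \<in> \<Union>Q" using \<sigma>_sub by blast
      with i show "v \<in> support Q (f \<alpha>)"
        using eq[of v] unfolding support_def f_def mem_Collect_eq by (metis restrict_apply')
    qed
  qed
  have f_in: "f \<alpha> \<in> topspace ?GQ" if "\<alpha> \<in> topspace ?GC" for \<alpha>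
  proof -
    have a: "\<forall>i\<in>I. 0 \<le> \<alpha> i" "(\<Sum>i\<in>I. \<alpha> i) = 1" "support ?C \<alpha> \<in> ?C"
      using that by (auto simp: topspace_geometric_realization UC)
    have "(\<Sum>v\<in>\<Union>Q. f \<alpha> v) = (\<Sum>i\<in>I. \<alpha> i * (\<Sum>v\<in>\<Union>Q. bary i v))"
      unfolding f_def sum_distrib_left by (subst sum.swap) simp
    also have "\<dots> = 1" using a(2) bary_sum by simp
    finally have "(\<Sum>v\<in>\<Union>Q. f \<alpha> v) = 1" .
    moreover have "0 \<le> f \<alpha> v" if "v \<in> \<Union>Q" for v
      using a(1) that unfolding f_def by (auto simp: bary_def intro!: sum_nonneg)
    moreover have "support Q (f \<alpha>) \<in> Q"
      using supp_f a by (auto simp: subset_nerve_def)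
    ultimately show ?thesis by (simp add: topspace_geometric_realization f_def)
  qed
  have \<phi>_pos: "0 \<le> \<phi> w i" "0 < \<phi> w i \<longleftrightarrow> \<sigma> i \<subseteq> support Q w"
    if "w \<in> topspace ?GQ" "i \<in> I" for w i
  proof -
    have w: "0 \<le> w v" if "v \<in> \<sigma> i" for v
      using \<open>w \<in> topspace ?GQ\<close> \<sigma>_sub[OF \<open>i \<in> I\<close>] that by (auto simp: topspace_geometric_realization)
    then show "0 \<le> \<phi> w i" by (auto simp: \<phi>_def intro: prod_nonneg)
    moreover have "\<phi> w i = 0 \<longleftrightarrow> (\<exists>v\<in>\<sigma> i. w v = 0)"
      using \<sigma>_fin[OF that(2)] by (auto simp: \<phi>_def)
    ultimately have "0 < \<phi> w i \<longleftrightarrow> (\<forall>v\<in>\<sigma> i. 0 < w v)"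
      using w by (metis less_le)
    also have "\<dots> \<longleftrightarrow> \<sigma> i \<subseteq> support Q w"
      unfolding support_def using \<sigma>_sub[OF that(2)] by blast
    finally show "0 < \<phi> w i \<longleftrightarrow> \<sigma> i \<subseteq> support Q w" .
  qed
  have \<phi>_sum: "0 < (\<Sum>j\<in>I. \<phi> w j)" if w: "w \<in> topspace ?GQ" for w
  proof -
    have "support Q w \<in> Q" using w by (simp add: topspace_geometric_realization)
    then obtain i where "i \<in> I" "\<sigma> i \<subseteq> support Q w" using cofinal by blast
    then show ?thesis using \<phi>_pos[OF w] fin(1) by (intro sum_pos2[of I i]) auto
  qed
  have supp_g: "support ?C (g w) = {i\<in>I. \<sigma> i \<subseteq> support Q w}" if "w \<in> topspace ?GQ" for w
    using \<phi>_pos[OF that] \<phi>_sum[OF that] by (auto simp: support_def[of ?C] UC g_def zero_less_divide_iff)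
  have g_in: "g w \<in> topspace ?GC" if w: "w \<in> topspace ?GQ" for w
  proof -
    have "(\<Sum>i\<in>I. g w i) = 1"
      using \<phi>_sum[OF w] by (simp add: g_def sum_divide_distrib[symmetric])
    moreover have "0 \<le> g w i" if "i \<in> I" for i
      using \<phi>_pos[OF w that] \<phi>_sum[OF w] that by (simp add: g_def)
    moreover have "support ?C (g w) \<in> ?C"
    proof -
      have s: "support Q w \<in> Q" using w by (simp add: topspace_geometric_realization)
      then obtain i where i: "i \<in> I" "\<sigma> i \<subseteq> support Q w" using cofinal by blast
      have "(\<Union>i\<in>{i\<in>I. \<sigma> i \<subseteq> support Q w}. \<sigma> i) \<in> Q"
        by (rule convex[OF \<sigma>[OF i(1)] s]) (use i in auto)
      then have "{i\<in>I. \<sigma> i \<subseteq> support Q w} \<in> ?C" using i by (auto simp: subset_nerve_def)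
      then show ?thesis unfolding supp_g[OF w] .
    qed
    ultimately show ?thesis by (simp add: topspace_geometric_realization UC g_def)
  qed
  have cf: "continuous_map ?GC ?GQ f"
  proof (rule continuous_map_into_realization)
    fix v assume "v \<in> \<Union>Q"
    moreover have "continuous_map ?GC euclideanreal (\<lambda>\<alpha>. \<Sum>i\<in>I. \<alpha> i * bary i v)"
      using fin(1) UC
      by (intro continuous_map_sum continuous_map_real_mult continuous_map_realization_coordinate) auto
    ultimately show "continuous_map ?GC euclideanreal (\<lambda>\<alpha>. f \<alpha> v)" by (simp add: f_def)
  qed (rule f_in)
  have cg: "continuous_map ?GQ ?GC g"
  proof (rule continuous_map_into_realization)
    fix i assume "i \<in> \<Union>?C"
    then have i: "i \<in> I" by (simp add: UC)
    have c: "continuous_map ?GQ euclideanreal (\<lambda>w. \<phi> w j)" if "j \<in> I" for j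
      unfolding \<phi>_def using \<sigma>_fin[OF that] \<sigma>_sub[OF that]
      by (intro continuous_map_prod continuous_map_realization_coordinate) auto
    have "continuous_map ?GQ euclideanreal (\<lambda>w. \<phi> w i / (\<Sum>j\<in>I. \<phi> w j))"
    proof (rule continuous_map_real_divide)
      show "continuous_map ?GQ euclideanreal (\<lambda>w. \<Sum>j\<in>I. \<phi> w j)"
        using fin(1) c by (rule continuous_map_sum)
      show "(\<Sum>j\<in>I. \<phi> w j) \<noteq> 0" if "w \<in> topspace ?GQ" for w
        using \<phi>_sum[OF that] by simp
    qed (rule c[OF i])
    then show "continuous_map ?GQ euclideanreal (\<lambda>w. g w i)" using i by (simp add: g_def)
  qed (rule g_in)
  have supp_gf: "support ?C \<alpha> \<subseteq> support ?C (g (f \<alpha>))" if "\<alpha> \<in> topspace ?GC" for \<alpha>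
  proof -
    have "\<forall>i\<in>I. 0 \<le> \<alpha> i" using that by (simp add: topspace_geometric_realization UC)
    then show ?thesis
      unfolding supp_g[OF f_in[OF that]] using supp_f[of \<alpha>] by (auto simp: support_def[of ?C] UC)
  qed
  have supp_fg: "support Q (f (g w)) \<subseteq> support Q w" if "w \<in> topspace ?GQ" for w
  proof -
    have "\<forall>i\<in>I. 0 \<le> g w i" using g_in[OF that] by (simp add: topspace_geometric_realization UC)
    then show ?thesis using supp_f[of "g w"] supp_g[OF that] by auto
  qed
  have gf: "homotopic_with (\<lambda>_. True) ?GC ?GC (g \<circ> f) id"
  proof (rule straight_line_homotopic)
    fix \<alpha> assume a: "\<alpha> \<in> topspace ?GC"
    have "support ?C (g (f \<alpha>)) \<in> ?C" using g_in[OF f_in[OF a]] by (simp add: topspace_geometric_realization)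
    then show "support ?C ((g \<circ> f) \<alpha>) \<union> support ?C (id \<alpha>) \<in> ?C"
      using supp_gf[OF a] by (simp add: Un_absorb2)
  qed (use cf cg in \<open>auto intro: continuous_map_compose\<close>)
  have fg: "homotopic_with (\<lambda>_. True) ?GQ ?GQ (f \<circ> g) id"
  proof (rule straight_line_homotopic)
    fix w assume w: "w \<in> topspace ?GQ"
    then have "support Q w \<in> Q" by (simp add: topspace_geometric_realization)
    then show "support Q ((f \<circ> g) w) \<union> support Q (id w) \<in> Q"
      using supp_fg[OF w] by (simp add: Un_absorb1)
  qed (use cf cg in \<open>auto intro: continuous_map_compose\<close>)
  show ?thesis
    unfolding homotopy_equivalent_space_def using cf cg gf fg by blast
qed

section \<open>Column sets of conf matrices\<close>

text \<open>These are the column sets of conf matrices, described without choosing the order of the columns: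
  monotone rows mean that any two columns are comparable entry by entry.\<close>

definition conf_columns :: "'v set set \<Rightarrow> 'v rel \<Rightarrow> nat \<Rightarrow> 'v list set \<Rightarrow> bool" where
  "conf_columns X r n T \<longleftrightarrow>
     finite T \<and> T \<noteq> {} \<and> (\<forall>c\<in>T. length c = n) \<and>
     (\<forall>c\<in>T. \<forall>d\<in>T. c \<noteq> d \<longrightarrow> (\<forall>i<n. (c ! i, d ! i) \<in> r) \<or> (\<forall>i<n. (d ! i, c ! i) \<in> r)) \<and>
     (\<forall>i<n. (\<lambda>c. c ! i) ` T \<in> X) \<and>
     (\<forall>i<n. \<forall>k<n. i \<noteq> k \<longrightarrow> (\<exists>c\<in>T. c ! i \<noteq> c ! k))"

lemma conf_columnsI:
  assumes "finite T" "T \<noteq> {}" "\<And>c. c \<in> T \<Longrightarrow> length c = n"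
    and "\<And>c d. c \<in> T \<Longrightarrow> d \<in> T \<Longrightarrow> c \<noteq> d \<Longrightarrow>
           (\<forall>i<n. (c ! i, d ! i) \<in> r) \<or> (\<forall>i<n. (d ! i, c ! i) \<in> r)"
    and "\<And>i. i < n \<Longrightarrow> (\<lambda>c. c ! i) ` T \<in> X"
    and "\<And>i k. i < n \<Longrightarrow> k < n \<Longrightarrow> i \<noteq> k \<Longrightarrow> \<exists>c\<in>T. c ! i \<noteq> c ! k"
  shows "conf_columns X r n T"
  unfolding conf_columns_def by (intro conjI ballI allI impI assms)

lemma conf_columnsD:
  assumes "conf_columns X r n T"
  shows "finite T" "T \<noteq> {}" "\<And>c. c \<in> T \<Longrightarrow> length c = n"
    and "\<And>c d. c \<in> T \<Longrightarrow> d \<in> T \<Longrightarrow> c \<noteq> d \<Longrightarrow>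
           (\<forall>i<n. (c ! i, d ! i) \<in> r) \<or> (\<forall>i<n. (d ! i, c ! i) \<in> r)"
    and "\<And>i. i < n \<Longrightarrow> (\<lambda>c. c ! i) ` T \<in> X"
    and "\<And>i k. i < n \<Longrightarrow> k < n \<Longrightarrow> i \<noteq> k \<Longrightarrow> \<exists>c\<in>T. c ! i \<noteq> c ! k"
  using assms by (simp_all add: conf_columns_def)

lemma conf_columns_transpose:
  assumes A: "conf_matrix X r n A" and n: "1 \<le> n"
  shows "conf_columns X r n (set (List.transpose A))"
proof -
  obtain m where m: "1 \<le> m" "length A = n" "\<And>i. i < n \<Longrightarrow> length (A ! i) = m"
    "List.transpose A = map (\<lambda>j. map (\<lambda>i. A ! i ! j) [0..<n]) [0..<m]"
    using conf_matrix_columns[OF A n] by metis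
  define col where "col j = map (\<lambda>i. A ! i ! j) [0..<n]" for j
  have T: "set (List.transpose A) = col ` {..<m}"
    by (simp add: m(4) col_def atLeast0LessThan)
  have col: "length (col j) = n" "i < n \<Longrightarrow> col j ! i = A ! i ! j" for i j
    by (simp_all add: col_def)
  have row: "sorted_wrt (\<lambda>x y. (x, y) \<in> r) (A ! i)" "set (A ! i) \<in> X" if "i < n" for i
    using A that m(2) by (auto simp: conf_matrix_def)
  have le: "(col j ! i, col k ! i) \<in> r" if "j < k" "k < m" "i < n" for i j k
    using sorted_wrt_nth_less[OF row(1)[OF that(3)] that(1)] that m(3) col(2) by simp
  have "(\<forall>i<n. (c ! i, d ! i) \<in> r) \<or> (\<forall>i<n. (d ! i, c ! i) \<in> r)"
    if cd: "c \<in> col ` {..<m}" "d \<in> col ` {..<m}" "c \<noteq> d" for c d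
  proof -
    obtain j k where jk: "j < m" "k < m" "c = col j" "d = col k" using cd by auto
    then have "j < k \<or> k < j" using cd(3) by (cases j k rule: linorder_cases) auto
    then show ?thesis using jk le by blast
  qed
  moreover have "(\<lambda>c. c ! i) ` (col ` {..<m}) \<in> X" if "i < n" for i
  proof -
    have "(\<lambda>c. c ! i) ` (col ` {..<m}) = (\<lambda>j. A ! i ! j) ` {..<m}"
      using that by (simp add: image_image col(2))
    also have "\<dots> = set (A ! i)" using m(3)[OF that] by (auto simp: set_conv_nth)
    finally show ?thesis using row(2)[OF that] by simp
  qed
  moreover have "\<exists>c\<in>col ` {..<m}. c ! i \<noteq> c ! k" if ik: "i < n" "k < n" "i \<noteq> k" for i k
  proof -
    have "A ! i \<noteq> A ! k"
      using A ik m(2) by (auto simp: conf_matrix_def nth_eq_iff_index_eq)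
    then obtain j where "j < m" "A ! i ! j \<noteq> A ! k ! j"
      using ik m(3) by (auto simp: list_eq_iff_nth_eq)
    then show ?thesis using ik col(2) by auto
  qed
  moreover have "col ` {..<m} \<noteq> {}" using m(1) by (auto simp: lessThan_empty_iff)
  moreover have "finite (col ` {..<m})" "\<forall>c\<in>col ` {..<m}. length c = n" using col(1) by auto
  ultimately show ?thesis unfolding conf_columns_def T by blast
qed

text \<open>Insertion sort: a new element goes after all elements that lie below it, and transitivity keeps
  the list sorted.\<close>
lemma finite_chain_sorted_list:
  assumes "finite T" "\<And>x y. x \<in> T \<Longrightarrow> y \<in> T \<Longrightarrow> x \<noteq> y \<Longrightarrow> P x y \<or> P y x" "transp P"
  shows "\<exists>L. set L = T \<and> sorted_wrt P L"
  using assms(1,2)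
proof (induction T rule: finite_induct)
  case (insert x T)
  then obtain L where L: "set L = T" "sorted_wrt P L" by (metis insertCI)
  let ?L = "filter (\<lambda>y. P y x) L @ x # filter (\<lambda>y. \<not> P y x) L"
  have x: "P x y" if "y \<in> T" "\<not> P y x" for y
    using insert.prems[of x y] insert.hyps(2) that by auto
  have "set ?L = insert x T" using L(1) by auto
  moreover have "sorted_wrt P ?L"
    using L x transpD[OF assms(3)] by (auto simp: sorted_wrt_append sorted_wrt_filter)
  ultimately show ?case by blast
qed simp

lemma conf_matrix_of_columns:
  assumes T: "conf_columns X r n T" and n: "1 \<le> n" and r: "trans r"
  obtains A where "conf_matrix X r n A" "set (List.transpose A) = T"
proof -
  have len: "\<And>c. c \<in> T \<Longrightarrow> length c = n" using T by (simp add: conf_columns_def)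
  have "transp (\<lambda>c d. \<forall>i<n. (c ! i, d ! i) \<in> r)"
    by (rule transpI) (use r in \<open>auto dest: transD\<close>)
  then have "\<exists>L. set L = T \<and> sorted_wrt (\<lambda>c d. \<forall>i<n. (c ! i, d ! i) \<in> r) L"
    using conf_columnsD(1,4)[OF T] by (intro finite_chain_sorted_list)
  then obtain L where L: "set L = T" "sorted_wrt (\<lambda>c d. \<forall>i<n. (c ! i, d ! i) \<in> r) L" by blast
  define A where "A = map (\<lambda>i. map (\<lambda>c. c ! i) L) [0..<n]"
  have LN: "L \<noteq> []" using T L(1) by (auto simp: conf_columns_def)
  have "sorted_wrt (\<lambda>x y. (x, y) \<in> r) (map (\<lambda>c. c ! i) L)" if "i < n" for i
    unfolding sorted_wrt_map using L(2) by (rule sorted_wrt_mono_rel[rotated]) (use that in auto)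
  moreover have "set (map (\<lambda>c. c ! i) L) \<in> X" if "i < n" for i
    using T that L(1) by (simp add: conf_columns_def)
  moreover have "inj_on (\<lambda>i. map (\<lambda>c. c ! i) L) {0..<n}"
  proof (rule inj_onI, rule ccontr)
    fix i k assume ik: "i \<in> {0..<n}" "k \<in> {0..<n}" "map (\<lambda>c. c ! i) L = map (\<lambda>c. c ! k) L" "i \<noteq> k"
    then obtain c where "c \<in> T" "c ! i \<noteq> c ! k" using conf_columnsD(6)[OF T, of i k] by auto
    with ik(3) L(1) show False by (metis map_eq_conv)
  qed
  moreover have "\<exists>m\<ge>1. \<forall>\<rho>\<in>set A. length \<rho> = m"
    using LN by (intro exI[of _ "length L"]) (auto simp: A_def Suc_le_eq)
  ultimately have "conf_matrix X r n A"
    by (auto simp: conf_matrix_def A_def distinct_map)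
  moreover have "List.transpose A = L"
  proof -
    have "List.transpose A = map (\<lambda>j. map (\<lambda>i. A ! i ! j) [0..<length A]) [0..<length L]"
      by (rule transpose_rectangle) (use n in \<open>auto simp: A_def\<close>)
    also have "\<dots> = L"
    proof (rule nth_equalityI)
      fix j assume "j < length (map (\<lambda>j. map (\<lambda>i. A ! i ! j) [0..<length A]) [0..<length L])"
      then have j: "j < length L" by simp
      then have "length (L ! j) = n" using len L(1) by auto
      with j show "map (\<lambda>j. map (\<lambda>i. A ! i ! j) [0..<length A]) [0..<length L] ! j = L ! j"
        by (intro nth_equalityI) (auto simp: A_def)
    qed simp
    finally show ?thesis .
  qed
  ultimately show ?thesis using that L(1) by blast
qed

text \<open>Comparability and faces pass to subsets, and the separation of rows passes to supersets.\<close>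
lemma conf_columns_convex:
  assumes X: "abstract_simplicial_complex X"
    and A: "conf_columns X r n A" and D: "conf_columns X r n D" and B: "A \<subseteq> B" "B \<subseteq> D"
  shows "conf_columns X r n B"
proof -
  show ?thesis
  proof (rule conf_columnsI)
    show "finite B" using conf_columnsD(1)[OF D] B(2) by (rule finite_subset[rotated])
    show "B \<noteq> {}" using conf_columnsD(2)[OF A] B(1) by blast
    show "length c = n" if "c \<in> B" for c using conf_columnsD(3)[OF D] that B(2) by blast
    show "(\<forall>i<n. (c ! i, d ! i) \<in> r) \<or> (\<forall>i<n. (d ! i, c ! i) \<in> r)"
      if "c \<in> B" "d \<in> B" "c \<noteq> d" for c d
      using conf_columnsD(4)[OF D, of c d] that B(2) by (simp add: subset_iff)
    show "(\<lambda>c. c ! i) ` B \<in> X" if "i < n" for i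
    proof -
      have "(\<lambda>c. c ! i) ` B \<subseteq> (\<lambda>c. c ! i) ` D" using B by blast
      moreover have "(\<lambda>c. c ! i) ` B \<noteq> {}" using \<open>B \<noteq> {}\<close> by simp
      ultimately show ?thesis
        using conf_columnsD(5)[OF D that] X unfolding abstract_simplicial_complex_def by blast
    qed
    show "\<exists>c\<in>B. c ! i \<noteq> c ! k" if "i < n" "k < n" "i \<noteq> k" for i k
      using conf_columnsD(6)[OF A that] B(1) by blast
  qed
qed

lemma delete_column_conf_matrix:
  assumes X: "abstract_simplicial_complex X"
    and M: "conf_matrix X r n M" and n: "1 \<le> n"
    and j: "j < length (List.transpose M)" and two: "length (List.transpose M) \<noteq> 1"
    and d: "distinct (delete_column j M)"
  shows "conf_matrix X r n (delete_column j M)"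
    and "length (List.transpose (delete_column j M)) < length (List.transpose M)"
    and "set (List.transpose (delete_column j M)) \<subseteq> set (List.transpose M)"
proof -
  obtain m where m: "1 \<le> m" "length M = n" "\<And>i. i < n \<Longrightarrow> length (M ! i) = m"
    "List.transpose M = map (\<lambda>j. map (\<lambda>i. M ! i ! j) [0..<n]) [0..<m]"
    using conf_matrix_columns[OF M n] by metis
  have jm: "j < m" "2 \<le> m" using j two m(1) by (simp_all add: m(4))
  let ?N = "delete_column j M"
  have row: "length \<rho> = m" "sorted_wrt (\<lambda>x y. (x, y) \<in> r) \<rho>" "set \<rho> \<in> X" if "\<rho> \<in> set M" for \<rho>
    using M m(2,3) that by (auto simp: conf_matrix_def in_set_conv_nth)
  have s: "sorted_wrt (\<lambda>x y. (x, y) \<in> r) (take j \<rho> @ drop (Suc j) \<rho>)" if "\<rho> \<in> set M" for \<rho>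
  proof -
    have "\<rho> = take j \<rho> @ \<rho> ! j # drop (Suc j) \<rho>"
      using jm(1) row(1)[OF that] by (simp add: id_take_nth_drop)
    then have "sorted_wrt (\<lambda>x y. (x, y) \<in> r) (take j \<rho> @ \<rho> ! j # drop (Suc j) \<rho>)"
      using row(2)[OF that] by simp
    then show ?thesis by (simp add: sorted_wrt_append)
  qed
  have f: "set (take j \<rho> @ drop (Suc j) \<rho>) \<in> X" if "\<rho> \<in> set M" for \<rho>
  proof -
    have "take j \<rho> @ drop (Suc j) \<rho> \<noteq> []" using jm row(1)[OF that] by auto
    then have "set (take j \<rho> @ drop (Suc j) \<rho>) \<noteq> {}" by (simp only: set_empty not_False_eq_True)
    moreover have "set (take j \<rho> @ drop (Suc j) \<rho>) \<subseteq> set \<rho>"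
      by (auto dest: in_set_takeD in_set_dropD)
    ultimately show ?thesis
      using row(3)[OF that] X unfolding abstract_simplicial_complex_def by blast
  qed
  have l: "length (take j \<rho> @ drop (Suc j) \<rho>) = m - 1" if "\<rho> \<in> set M" for \<rho>
    using jm row(1)[OF that] by auto
  show N: "conf_matrix X r n ?N"
    unfolding conf_matrix_def
  proof (intro conjI)
    show "\<exists>k\<ge>1. \<forall>\<rho>\<in>set ?N. length \<rho> = k"
      using jm l by (intro exI[of _ "m - 1"]) (simp add: delete_column_def del: length_append)
  qed (use d s f m(2) in \<open>auto simp: delete_column_def\<close>)
  have N_nth: "?N ! i ! k = M ! i ! (if k < j then k else Suc k)" if "i < n" "k < m - 1" for i k
    using that m(2,3) jm by (auto simp: delete_column_def nth_append min_def)
  have "List.transpose ?N = map (\<lambda>k. map (\<lambda>i. ?N ! i ! k) [0..<length ?N]) [0..<m - 1]"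
    using n m(2,3) jm by (intro transpose_rectangle) (auto simp: delete_column_def)
  then have tN: "List.transpose ?N = map (\<lambda>k. map (\<lambda>i. ?N ! i ! k) [0..<n]) [0..<m - 1]"
    using m(2) by (simp add: delete_column_def)
  then show "length (List.transpose ?N) < length (List.transpose M)"
    using jm by (simp add: m(4))
  have "map (\<lambda>i. ?N ! i ! k) [0..<n] \<in> set (List.transpose M)" if "k < m - 1" for k
  proof -
    have "map (\<lambda>i. ?N ! i ! k) [0..<n] = map (\<lambda>i. M ! i ! (if k < j then k else Suc k)) [0..<n]"
      using N_nth that by auto
    moreover have "(if k < j then k else Suc k) \<in> set [0..<m]" using that by auto
    ultimately show ?thesis unfolding m(4) set_map by blast
  qed
  then show "set (List.transpose ?N) \<subseteq> set (List.transpose M)"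
    unfolding tN by auto
qed

text \<open>Among the conf matrices with columns in \<open>T\<close>, take one with the fewest columns. If it has at least two, then
  deleting any of them makes two rows equal, since the result would otherwise be a smaller conf matrix.\<close>
lemma minimal_conf_matrix_below:
  assumes X: "abstract_simplicial_complex X" and T: "conf_columns X r n T"
    and n: "1 \<le> n" and r: "trans r"
  obtains M where "minimal_conf_matrix X r n M" "set (List.transpose M) \<subseteq> T"
proof -
  let ?P = "\<lambda>M. conf_matrix X r n M \<and> set (List.transpose M) \<subseteq> T"
  obtain A where "?P A" using conf_matrix_of_columns[OF T n r] by blast
  then obtain M where M: "?P M" "\<And>N. ?P N \<Longrightarrow> length (List.transpose M) \<le> length (List.transpose N)"
    using ex_has_least_nat[of ?P A "\<lambda>M. length (List.transpose M)"] by blast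
  have "\<not> distinct (delete_column j M)"
    if "length (List.transpose M) \<noteq> 1" "j < length (List.transpose M)" for j
    using delete_column_conf_matrix[OF X conjunct1[OF M(1)] n that(2,1)] M by (meson leD subset_trans)
  then show ?thesis using M(1) that by (auto simp: minimal_conf_matrix_def)
qed

lemma conf_columns_Union_lists:
  assumes "conf_columns X r n T" "c \<in> T"
  shows "length c = n \<and> set c \<subseteq> \<Union>X"
proof -
  have "c ! i \<in> \<Union>X" if "i < n" for i
    using conf_columnsD(5)[OF assms(1) that] assms(2) by blast
  then show ?thesis using conf_columnsD(3)[OF assms] by (auto simp: set_conv_nth)
qed

lemma finite_Union_conf_columns:
  assumes "finite (\<Union>X)"
  shows "finite (\<Union>{T. conf_columns X r n T})"
proof (rule finite_subset)
  show "\<Union>{T. conf_columns X r n T} \<subseteq> {c. set c \<subseteq> \<Union>X \<and> length c = n}"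
    using conf_columns_Union_lists by blast
  show "finite {c. set c \<subseteq> \<Union>X \<and> length c = n}" using assms by (rule finite_lists_length_eq)
qed

section \<open>A point of the complex as a partition of the unit interval\<close>

locale ordered_complex =
  fixes X :: "'v set set" and r :: "'v rel" and n :: nat
  assumes complex: "abstract_simplicial_complex X"
    and finite_complex: "finite X"
    and order: "facewise_linear_order X r"
    and n_pos: "1 \<le> n"
begin

(* Membership in a union of faces or of column sets is kept as an atom, so that the simplifier
   does not introduce a face for it. *)
declare Union_iff [simp del]

lemma finite_vertices: "finite (\<Union>X)"
  using complex finite_complex by (auto simp: abstract_simplicial_complex_def)

lemma trans_order: "trans r"
  using order by (simp add: facewise_linear_order_def partial_order_on_def preorder_on_def)

lemma antisym_order: "antisym r"
  using order by (simp add: facewise_linear_order_def partial_order_on_def)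

lemma refl_order: "v \<in> \<Union>X \<Longrightarrow> (v, v) \<in> r"
  using order unfolding facewise_linear_order_def partial_order_on_def preorder_on_def
  by (metis refl_onD)

lemma total_order:
  assumes "\<sigma> \<in> X" "u \<in> \<sigma>" "v \<in> \<sigma>"
  shows "(u, v) \<in> r \<or> (v, u) \<in> r"
proof (cases "u = v")
  case True
  then show ?thesis using assms refl_order by blast
next
  case False
  have "total_on \<sigma> (Restr r \<sigma>)"
    using order assms(1) by (simp add: facewise_linear_order_def linear_order_on_def)
  then show ?thesis using assms(2,3) False by (auto simp: total_on_def)
qed

definition below :: "('v \<Rightarrow> real) \<Rightarrow> 'v \<Rightarrow> real" where
  "below \<alpha> v = (\<Sum>u\<in>{u\<in>\<Union>X. (u, v) \<in> r \<and> u \<noteq> v}. \<alpha> u)"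

text \<open>The cells are half-open so that they are disjoint and cover the interval from 0 to 1, without
  the endpoint 1. A vertex of weight 0 has an empty cell.\<close>

definition cell :: "('v \<Rightarrow> real) \<Rightarrow> 'v \<Rightarrow> real set" where
  "cell \<alpha> v = {below \<alpha> v..<below \<alpha> v + \<alpha> v}"

lemma below_add:
  assumes "v \<in> \<Union>X"
  shows "below \<alpha> v + \<alpha> v = (\<Sum>u\<in>{u\<in>\<Union>X. (u, v) \<in> r}. \<alpha> u)"
proof -
  have "{u\<in>\<Union>X. (u, v) \<in> r} = insert v {u\<in>\<Union>X. (u, v) \<in> r \<and> u \<noteq> v}"
    using assms refl_order by blast
  then show ?thesis using finite_vertices by (simp add: below_def add.commute)
qed

lemma below_nonneg:
  assumes "\<alpha> \<in> topspace (geometric_realization X)"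
  shows "0 \<le> below \<alpha> v"
  unfolding below_def by (rule sum_nonneg) (use realization_nonneg[OF assms] in blast)

lemma below_add_le:
  assumes \<alpha>: "\<alpha> \<in> topspace (geometric_realization X)"
    and uv: "u \<in> \<Union>X" "(u, v) \<in> r" "u \<noteq> v"
  shows "below \<alpha> u + \<alpha> u \<le> below \<alpha> v"
  unfolding below_add[OF uv(1)] unfolding below_def
proof (rule sum_mono2)
  show "finite {u\<in>\<Union>X. (u, v) \<in> r \<and> u \<noteq> v}" using finite_vertices by simp
  show "{w\<in>\<Union>X. (w, u) \<in> r} \<subseteq> {w\<in>\<Union>X. (w, v) \<in> r \<and> w \<noteq> v}"
    using uv transD[OF trans_order] antisymD[OF antisym_order] by blast
qed (use realization_nonneg[OF \<alpha>] in blast)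

lemma support_subset: "support X \<alpha> \<subseteq> \<Union>X"
  by (auto simp: support_def)

lemma cell_imp_support: "t \<in> cell \<alpha> v \<Longrightarrow> v \<in> \<Union>X \<Longrightarrow> v \<in> support X \<alpha>"
  unfolding support_def cell_def mem_Collect_eq by auto

text \<open>If the vertices were in the opposite order, the cell of \<open>v\<close> would end before that of \<open>u\<close> begins.\<close>
lemma cell_monotone:
  assumes \<alpha>: "\<alpha> \<in> topspace (geometric_realization X)"
    and uv: "u \<in> \<Union>X" "v \<in> \<Union>X" and s: "s \<in> cell \<alpha> u" and t: "t \<in> cell \<alpha> v" and "s \<le> t"
  shows "(u, v) \<in> r"
proof (rule ccontr)
  assume n: "(u, v) \<notin> r"
  then have "(v, u) \<in> r"
    using total_order[OF realization_support[OF \<alpha>]] cell_imp_support s t uv by blast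
  moreover have "v \<noteq> u" using n refl_order uv(1) by blast
  ultimately have "below \<alpha> v + \<alpha> v \<le> below \<alpha> u"
    by (rule below_add_le[OF \<alpha> uv(2)])
  then show False using s t \<open>s \<le> t\<close> by (simp add: cell_def)
qed

lemma cell_unique:
  assumes \<alpha>: "\<alpha> \<in> topspace (geometric_realization X)"
    and uv: "u \<in> \<Union>X" "v \<in> \<Union>X" and t: "t \<in> cell \<alpha> u" "t \<in> cell \<alpha> v"
  shows "u = v"
  using cell_monotone[OF \<alpha> uv t] cell_monotone[OF \<alpha> uv(2,1) t(2,1)] antisymD[OF antisym_order]
  by blast

lemma cell_subset_unit:
  assumes \<alpha>: "\<alpha> \<in> topspace (geometric_realization X)" and v: "v \<in> \<Union>X"
  shows "cell \<alpha> v \<subseteq> {0..<1}"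
proof -
  have "below \<alpha> v + \<alpha> v \<le> 1"
    unfolding below_add[OF v] realization_sum[OF \<alpha>, symmetric]
    by (rule sum_mono2[OF finite_vertices]) (use realization_nonneg[OF \<alpha>] in blast)+
  then show ?thesis
    using below_nonneg[OF \<alpha>] by (auto simp: cell_def intro: order_trans)
qed

lemma sum_support:
  assumes "\<alpha> \<in> topspace (geometric_realization X)" and "A \<subseteq> \<Union>X"
  shows "sum \<alpha> A = sum \<alpha> (A \<inter> support X \<alpha>)"
proof (rule sum.mono_neutral_right)
  show "finite A" using finite_vertices assms(2) by (rule finite_subset[rotated])
  show "\<forall>i\<in>A - A \<inter> support X \<alpha>. \<alpha> i = 0"
  proof
    fix i assume i: "i \<in> A - A \<inter> support X \<alpha>"
    then have "i \<in> \<Union>X" using assms(2) by blast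
    moreover have "\<not> 0 < \<alpha> i" using i \<open>i \<in> \<Union>X\<close> unfolding support_def by blast
    ultimately show "\<alpha> i = 0" using realization_nonneg[OF assms(1)] by fastforce
  qed
qed blast

text \<open>The vertices of the support whose cell ends at or before \<open>t\<close> have total weight at most \<open>t\<close>, hence do not exhaust
  the support. The cell of the first remaining vertex begins at or before \<open>t\<close> and ends after it.\<close>
lemma cell_cover:
  assumes \<alpha>: "\<alpha> \<in> topspace (geometric_realization X)" and t: "0 \<le> t" "t < 1"
  obtains v where "v \<in> \<Union>X" "t \<in> cell \<alpha> v"
proof -
  let ?S = "support X \<alpha>" and ?b = "below \<alpha>"
  note nonneg = realization_nonneg[OF \<alpha>]
  have fS: "finite ?S" using support_subset finite_vertices by (rule finite_subset)
  have V: "v \<in> \<Union>X" "0 < \<alpha> v" if "v \<in> ?S" for v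
    using that unfolding support_def by blast+
  have le: "(u, v) \<in> r" if "u \<in> ?S" "v \<in> ?S" "?b u \<le> ?b v" for u v
  proof (rule ccontr)
    assume n: "(u, v) \<notin> r"
    then have "(v, u) \<in> r" "v \<noteq> u"
      using total_order[OF realization_support[OF \<alpha>]] that refl_order V(1) by blast+
    then have "?b v + \<alpha> v \<le> ?b u" by (rule below_add_le[OF \<alpha> V(1)[OF that(2)]])
    then show False using that V(2)[OF that(2)] by linarith
  qed
  define D where "D = {u\<in>?S. ?b u + \<alpha> u \<le> t}"
  have D: "D \<subseteq> ?S" "finite D" using fS by (auto simp: D_def)
  have sum_D: "sum \<alpha> D \<le> t"
  proof (cases "D = {}")
    case False
    \<comment> \<open>The last vertex of \<open>D\<close>: all of \<open>D\<close> is counted in the right end of its cell.\<close>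
    obtain m where m: "m \<in> D" "\<And>u. u \<in> D \<Longrightarrow> ?b u \<le> ?b m"
      using arg_min_if_finite(1)[OF D(2) False, of "\<lambda>u. - ?b u"] arg_min_least[OF D(2) False, of _ "\<lambda>u. - ?b u"]
      by (metis neg_le_iff_le)
    have "D \<subseteq> {u\<in>\<Union>X. (u, m) \<in> r}"
      using le m D(1) V(1) by blast
    then have "sum \<alpha> D \<le> sum \<alpha> {u\<in>\<Union>X. (u, m) \<in> r}"
      using finite_vertices nonneg by (intro sum_mono2) auto
    also have "\<dots> = ?b m + \<alpha> m" using below_add[OF V(1)] m(1) D(1) by (simp add: subset_iff)
    also have "\<dots> \<le> t" using m(1) by (simp add: D_def)
    finally show ?thesis .
  qed (use t in simp)
  have "sum \<alpha> ?S = 1"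
    using sum_support[OF \<alpha>, of "\<Union>X"] realization_sum[OF \<alpha>] support_subset by (simp add: Int_absorb1)
  then have "?S - D \<noteq> {}" using sum_D t D(1) by (metis Diff_eq_empty_iff leD subset_antisym)
  \<comment> \<open>Left ends of cells order the support as \<open>r\<close> does, so their minimum gives the first vertex.\<close>
  then obtain v where v: "v \<in> ?S - D" "\<And>u. u \<in> ?S - D \<Longrightarrow> ?b v \<le> ?b u"
    using fS by (metis arg_min_if_finite(1) arg_min_least finite_Diff)
  have "{u\<in>\<Union>X. (u, v) \<in> r \<and> u \<noteq> v} \<inter> ?S \<subseteq> D"
  proof
    fix u assume u: "u \<in> {u\<in>\<Union>X. (u, v) \<in> r \<and> u \<noteq> v} \<inter> ?S"
    then have "?b u + \<alpha> u \<le> ?b v" by (intro below_add_le[OF \<alpha>]) blast+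
    then have "?b u < ?b v" using V(2)[of u] u by simp
    then show "u \<in> D" using v(2)[of u] u by (meson DiffI IntD2 leD)
  qed
  then have "sum \<alpha> ({u\<in>\<Union>X. (u, v) \<in> r \<and> u \<noteq> v} \<inter> ?S) \<le> sum \<alpha> D"
    using D V(2) by (intro sum_mono2) (auto intro!: less_imp_le[OF V(2)])
  moreover have "?b v = sum \<alpha> ({u\<in>\<Union>X. (u, v) \<in> r \<and> u \<noteq> v} \<inter> ?S)"
    unfolding below_def by (rule sum_support[OF \<alpha>]) blast+
  ultimately have "?b v \<le> t" using sum_D by linarith
  moreover have "t < ?b v + \<alpha> v" using v(1) by (auto simp: D_def)
  ultimately show ?thesis using that[of v] V(1)[of v] v(1) by (simp add: cell_def)
qed

section \<open>Common refinements\<close>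

abbreviation columns :: "'v list set" where
  "columns \<equiv> {c. set c \<subseteq> \<Union>X \<and> length c = n}"

abbreviation column_sets :: "'v list set set" where
  "column_sets \<equiv> {T. conf_columns X r n T}"

definition common_cell :: "(nat \<Rightarrow> 'v \<Rightarrow> real) \<Rightarrow> 'v list \<Rightarrow> real set" where
  "common_cell z c = (\<Inter>i<n. cell (z i) (c ! i))"

text \<open>Defining the weight as a measure makes finite additivity available; as the common cell is an
  interval, the weight is also the explicit expression in \<open>weight_eq\<close>, which gives continuity.\<close>

definition weight :: "(nat \<Rightarrow> 'v \<Rightarrow> real) \<Rightarrow> 'v list \<Rightarrow> real" where
  "weight z c = measure lborel (common_cell z c)"

lemma columns_nth: "c \<in> columns \<Longrightarrow> i < n \<Longrightarrow> c ! i \<in> \<Union>X"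
  using nth_mem[of i c] by blast

lemma finite_columns: "finite columns"
  using finite_vertices by (rule finite_lists_length_eq)

lemma finite_Union_column_sets: "finite (\<Union>column_sets)"
  using finite_vertices by (rule finite_Union_conf_columns)

lemma Union_column_sets_subset: "\<Union>column_sets \<subseteq> columns"
  using conf_columns_Union_lists by blast

lemma common_cell_interval:
  "common_cell z c =
     {Max ((\<lambda>i. below (z i) (c ! i)) ` {..<n})..<Min ((\<lambda>i. below (z i) (c ! i) + z i (c ! i)) ` {..<n})}"
proof -
  have ne: "f ` {..<n} \<noteq> {}" for f :: "nat \<Rightarrow> real" using n_pos by (auto simp: lessThan_empty_iff)
  show ?thesis
    by (intro set_eqI) (simp add: common_cell_def cell_def Max_le_iff[OF _ ne] Min_gr_iff[OF _ ne], blast)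
qed

lemma weight_eq:
  "weight z c = max 0 (Min ((\<lambda>i. below (z i) (c ! i) + z i (c ! i)) ` {..<n})
                       - Max ((\<lambda>i. below (z i) (c ! i)) ` {..<n}))"
  unfolding weight_def common_cell_interval by (simp add: max_def)

lemma weight_nonneg: "0 \<le> weight z c"
  by (simp add: weight_def)

lemma weight_pos_common_cell: "0 < weight z c \<Longrightarrow> common_cell z c \<noteq> {}"
  by (auto simp: weight_def)

lemma common_cellD: "t \<in> common_cell z c \<Longrightarrow> i < n \<Longrightarrow> t \<in> cell (z i) (c ! i)"
  by (simp add: common_cell_def)

text \<open>The common cells of the columns with entry \<open>v\<close> in row \<open>i\<close> partition the cell of \<open>v\<close> in row \<open>i\<close>,
  because the cells of every other row partition the unit interval.\<close>
lemma sum_weight: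
  assumes "z \<in> {..<n} \<rightarrow> topspace (geometric_realization X)"
    and i: "i < n" and v: "v \<in> \<Union>X"
  shows "(\<Sum>c\<in>{c\<in>columns. c ! i = v}. weight z c) = z i v"
proof -
  have z: "\<And>i. i < n \<Longrightarrow> z i \<in> topspace (geometric_realization X)" using assms(1) by auto
  let ?C = "{c\<in>columns. c ! i = v}"
  have "(\<Sum>c\<in>?C. weight z c) = measure lborel (\<Union>c\<in>?C. common_cell z c)"
    unfolding weight_def
  proof (rule measure_finite_Union[symmetric])
    show "finite ?C" using finite_columns by (rule rev_finite_subset) blast
    show "common_cell z ` ?C \<subseteq> sets lborel" by (auto simp: common_cell_interval)
    show "disjoint_family_on (common_cell z) ?C"
      unfolding disjoint_family_on_def
    proof (intro ballI impI equals0I)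
      fix c d t assume cd: "c \<in> ?C" "d \<in> ?C" "c \<noteq> d" and t: "t \<in> common_cell z c \<inter> common_cell z d"
      then obtain k where k: "k < n" "c ! k \<noteq> d ! k" by (auto simp: list_eq_iff_nth_eq)
      have "c ! k = d ! k"
        using cell_unique[OF z[OF k(1)]] columns_nth[OF _ k(1)] cd t common_cellD[OF _ k(1)] by blast
      with k(2) show False ..
    qed
    show "emeasure lborel (common_cell z c) \<noteq> \<infinity>" for c
      unfolding common_cell_interval
      by (cases "Max ((\<lambda>i. below (z i) (c ! i)) ` {..<n}) \<le> Min ((\<lambda>i. below (z i) (c ! i) + z i (c ! i)) ` {..<n})") auto
  qed
  also have "(\<Union>c\<in>?C. common_cell z c) = cell (z i) v"
  proof
    show "(\<Union>c\<in>?C. common_cell z c) \<subseteq> cell (z i) v" using common_cellD i by blast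
    show "cell (z i) v \<subseteq> (\<Union>c\<in>?C. common_cell z c)"
    proof
      fix t assume t: "t \<in> cell (z i) v"
      then have t01: "0 \<le> t" "t < 1" using cell_subset_unit[OF z[OF i] v] by auto
      have "\<exists>u. u \<in> \<Union>X \<and> t \<in> cell (z k) u \<and> (k = i \<longrightarrow> u = v)" if "k < n" for k
        using cell_cover[OF z[OF that] t01] t v by blast
      \<comment> \<open>The column at time \<open>t\<close>, with the entry in row \<open>i\<close> prescribed.\<close>
      then obtain f where f: "\<And>k. k < n \<Longrightarrow> f k \<in> \<Union>X \<and> t \<in> cell (z k) (f k) \<and> (k = i \<longrightarrow> f k = v)"
        by metis
      have "map f [0..<n] \<in> ?C" using f i by fastforce
      moreover have "t \<in> common_cell z (map f [0..<n])" using f by (simp add: common_cell_def)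
      ultimately show "t \<in> (\<Union>c\<in>?C. common_cell z c)" by blast
    qed
  qed
  also have "measure lborel (cell (z i) v) = z i v"
    using realization_nonneg[OF z[OF i] v] by (simp add: cell_def)
  finally show ?thesis .
qed

section \<open>The triangulated configuration space\<close>

definition positive_columns :: "(nat \<Rightarrow> 'v \<Rightarrow> real) \<Rightarrow> 'v list set" where
  "positive_columns z = {c\<in>columns. 0 < weight z c}"

text \<open>\<open>refine\<close> and \<open>marginals\<close> are the two directions of the homeomorphism between the configuration space
  and the realization of the column sets of conf matrices. Both are restricted to the vertex sets in
  question because points of a realization are extensional functions.\<close>

definition refine :: "(nat \<Rightarrow> 'v \<Rightarrow> real) \<Rightarrow> 'v list \<Rightarrow> real" where
  "refine z = restrict (weight z) (\<Union>column_sets)"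

definition marginals :: "('v list \<Rightarrow> real) \<Rightarrow> nat \<Rightarrow> 'v \<Rightarrow> real" where
  "marginals w = (\<lambda>i\<in>{..<n}. \<lambda>v\<in>\<Union>X. (\<Sum>c\<in>{c\<in>\<Union>column_sets. c ! i = v}. w c))"

lemma sum_weight_positive:
  assumes z: "z \<in> {..<n} \<rightarrow> topspace (geometric_realization X)"
    and i: "i < n" and v: "v \<in> \<Union>X"
    and S: "positive_columns z \<subseteq> S" "S \<subseteq> columns"
  shows "(\<Sum>c\<in>{c\<in>S. c ! i = v}. weight z c) = z i v"
  unfolding sum_weight[OF z i v, symmetric]
proof (rule sum.mono_neutral_left)
  show "finite {c\<in>columns. c ! i = v}" using finite_columns by (rule rev_finite_subset) blast
  show "{c\<in>S. c ! i = v} \<subseteq> {c\<in>columns. c ! i = v}" using S(2) by blast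
  show "\<forall>c\<in>{c\<in>columns. c ! i = v} - {c\<in>S. c ! i = v}. weight z c = 0"
  proof
    fix c assume "c \<in> {c\<in>columns. c ! i = v} - {c\<in>S. c ! i = v}"
    then have "\<not> 0 < weight z c" using S(1) unfolding positive_columns_def by blast
    then show "weight z c = 0" using weight_nonneg[of z c] by linarith
  qed
qed

lemma sum_by_row:
  assumes "i < n" "S \<subseteq> columns"
  shows "(\<Sum>v\<in>\<Union>X. \<Sum>c\<in>{c\<in>S. c ! i = v}. w c) = sum w S"
proof (rule sum.group)
  show "finite S" using finite_columns assms(2) by (rule rev_finite_subset)
  show "(\<lambda>c. c ! i) ` S \<subseteq> \<Union>X" using columns_nth assms by blast
qed (rule finite_vertices)

text \<open>Take a time in the common cell of each column. The vertex at the earlier time is at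
  most the vertex at the later time in every row.\<close>
lemma positive_columns_chain:
  assumes z: "z \<in> {..<n} \<rightarrow> topspace (geometric_realization X)"
    and cd: "c \<in> positive_columns z" "d \<in> positive_columns z"
  shows "(\<forall>i<n. (c ! i, d ! i) \<in> r) \<or> (\<forall>i<n. (d ! i, c ! i) \<in> r)"
proof -
  have zi: "\<And>i. i < n \<Longrightarrow> z i \<in> topspace (geometric_realization X)" using z by auto
  have mem: "c \<in> columns" "d \<in> columns" and "common_cell z c \<noteq> {}" "common_cell z d \<noteq> {}"
    using cd weight_pos_common_cell unfolding positive_columns_def by blast+
  then obtain s t where st: "s \<in> common_cell z c" "t \<in> common_cell z d" by blast
  have "s \<le> t \<or> t \<le> s" by linarith
  then show ?thesis
  proof
    assume "s \<le> t"
    then have "(c ! i, d ! i) \<in> r" if "i < n" for i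
      using cell_monotone[OF zi[OF that] columns_nth[OF mem(1) that] columns_nth[OF mem(2) that]
          common_cellD[OF st(1) that] common_cellD[OF st(2) that]] by blast
    then show ?thesis by blast
  next
    assume "t \<le> s"
    then have "(d ! i, c ! i) \<in> r" if "i < n" for i
      using cell_monotone[OF zi[OF that] columns_nth[OF mem(2) that] columns_nth[OF mem(1) that]
          common_cellD[OF st(2) that] common_cellD[OF st(1) that]] by blast
    then show ?thesis by blast
  qed
qed

lemma positive_columns_row:
  assumes z: "z \<in> {..<n} \<rightarrow> topspace (geometric_realization X)" and i: "i < n"
  shows "(\<lambda>c. c ! i) ` positive_columns z = support X (z i)"
proof
  show "(\<lambda>c. c ! i) ` positive_columns z \<subseteq> support X (z i)"
  proof
    fix v assume "v \<in> (\<lambda>c. c ! i) ` positive_columns z"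
    then obtain c where c: "c \<in> columns" "0 < weight z c" "v = c ! i"
      unfolding positive_columns_def by blast
    then obtain t where "t \<in> common_cell z c" using weight_pos_common_cell by blast
    then show "v \<in> support X (z i)"
      using cell_imp_support[OF common_cellD[OF _ i] columns_nth[OF c(1) i]] c(3) by blast
  qed
  show "support X (z i) \<subseteq> (\<lambda>c. c ! i) ` positive_columns z"
  proof
    fix v assume v: "v \<in> support X (z i)"
    then have "v \<in> \<Union>X" "0 < z i v" unfolding support_def by blast+
    moreover have "positive_columns z \<subseteq> columns" unfolding positive_columns_def by blast
    ultimately have "(\<Sum>c\<in>{c\<in>positive_columns z. c ! i = v}. weight z c) \<noteq> 0"
      using sum_weight_positive[OF z i _ order_refl] by simp
    then have "{c\<in>positive_columns z. c ! i = v} \<noteq> {}" by (metis (no_types) sum.empty)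
    then show "v \<in> (\<lambda>c. c ! i) ` positive_columns z" by blast
  qed
qed

text \<open>Rows \<open>i\<close> and \<open>k\<close> of these columns differ since the points \<open>z i\<close> and \<open>z k\<close> do: equal rows would give
  equal marginals, and the marginals of the weights are the given points.\<close>
lemma conf_columns_positive_columns:
  assumes z: "z \<in> topspace (Conf n (geometric_realization X))"
  shows "conf_columns X r n (positive_columns z)"
proof (rule conf_columnsI)
  have zi: "\<And>i. i < n \<Longrightarrow> z i \<in> topspace (geometric_realization X)" and zP: "z \<in> {..<n} \<rightarrow> topspace (geometric_realization X)"
    using z by (auto simp: topspace_Conf)
  have sub: "positive_columns z \<subseteq> columns" unfolding positive_columns_def by blast
  show "finite (positive_columns z)" using finite_columns sub by (rule rev_finite_subset)
  show "length c = n" if "c \<in> positive_columns z" for c using sub that by blast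
  show "(\<forall>i<n. (c ! i, d ! i) \<in> r) \<or> (\<forall>i<n. (d ! i, c ! i) \<in> r)"
    if "c \<in> positive_columns z" "d \<in> positive_columns z" for c d
    using positive_columns_chain[OF zP that] .
  show face: "(\<lambda>c. c ! i) ` positive_columns z \<in> X" if "i < n" for i
    using positive_columns_row[OF zP that] realization_support[OF zi[OF that]] by simp
  have "0 < n" using n_pos by simp
  then show "positive_columns z \<noteq> {}"
    using face complex unfolding abstract_simplicial_complex_def by blast
  show "\<exists>c\<in>positive_columns z. c ! i \<noteq> c ! k" if ik: "i < n" "k < n" "i \<noteq> k" for i k
  proof (rule ccontr)
    assume "\<not> (\<exists>c\<in>positive_columns z. c ! i \<noteq> c ! k)"
    then have eq: "{c\<in>positive_columns z. c ! i = v} = {c\<in>positive_columns z. c ! k = v}" for v by auto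
    have "z i v = z k v" if "v \<in> \<Union>X" for v
      using sum_weight_positive[OF zP ik(1) that order_refl sub]
        sum_weight_positive[OF zP ik(2) that order_refl sub] eq[of v] by simp
    then have "z i = z k"
      using realization_extensional[OF zi[OF ik(1)]] realization_extensional[OF zi[OF ik(2)]]
      by (intro extensionalityI) auto
    then show False using z ik by (auto simp: topspace_Conf inj_on_def)
  qed
qed

lemma refine_in_realization:
  assumes z: "z \<in> topspace (Conf n (geometric_realization X))"
  shows "refine z \<in> topspace (geometric_realization column_sets)"
proof -
  have zi: "\<And>i. i < n \<Longrightarrow> z i \<in> topspace (geometric_realization X)" and zP: "z \<in> {..<n} \<rightarrow> topspace (geometric_realization X)"
    using z by (auto simp: topspace_Conf)
  have T: "positive_columns z \<in> column_sets" using conf_columns_positive_columns[OF z] by simp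
  then have sub: "positive_columns z \<subseteq> \<Union>column_sets" by blast
  have n0: "0 < n" using n_pos by simp
  have "(\<Sum>c\<in>\<Union>column_sets. refine z c) = (\<Sum>c\<in>\<Union>column_sets. weight z c)"
    by (rule sum.cong) (simp_all add: refine_def)
  also have "\<dots> = (\<Sum>v\<in>\<Union>X. \<Sum>c\<in>{c\<in>\<Union>column_sets. c ! 0 = v}. weight z c)"
    by (rule sum_by_row[OF n0 Union_column_sets_subset, symmetric])
  also have "\<dots> = (\<Sum>v\<in>\<Union>X. z 0 v)"
    by (rule sum.cong) (simp_all add: sum_weight_positive[OF zP n0 _ sub Union_column_sets_subset])
  also have "\<dots> = 1" by (rule realization_sum[OF zi[OF n0]])
  finally have "(\<Sum>c\<in>\<Union>column_sets. refine z c) = 1" .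
  moreover have "support column_sets (refine z) = positive_columns z"
  proof -
    have "support column_sets (refine z) = {c\<in>\<Union>column_sets. 0 < weight z c}"
      unfolding support_def refine_def by (metis restrict_apply')
    moreover have "c \<in> \<Union>column_sets \<and> 0 < weight z c \<longleftrightarrow> c \<in> positive_columns z" for c
      using subsetD[OF sub, of c] subsetD[OF Union_column_sets_subset, of c]
      unfolding positive_columns_def mem_Collect_eq by argo
    ultimately show ?thesis by simp
  qed
  ultimately show ?thesis
    using T by (simp add: topspace_geometric_realization refine_def weight_nonneg)
qed

lemma marginals_refine:
  assumes z: "z \<in> topspace (Conf n (geometric_realization X))"
  shows "marginals (refine z) = z"
proof (rule extensionalityI[of _ "{..<n}"])
  have zi: "\<And>i. i < n \<Longrightarrow> z i \<in> topspace (geometric_realization X)" and zP: "z \<in> {..<n} \<rightarrow> topspace (geometric_realization X)"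
    using z by (auto simp: topspace_Conf)
  have sub: "positive_columns z \<subseteq> \<Union>column_sets" using conf_columns_positive_columns[OF z] by blast
  show "marginals (refine z) \<in> extensional {..<n}" by (simp add: marginals_def)
  show "z \<in> extensional {..<n}" using z by (simp add: topspace_Conf)
  fix i assume "i \<in> {..<n}"
  then have i: "i < n" by simp
  show "marginals (refine z) i = z i"
  proof (rule extensionalityI[of _ "\<Union>X"])
    show "marginals (refine z) i \<in> extensional (\<Union>X)" using i by (simp add: marginals_def)
    show "z i \<in> extensional (\<Union>X)" by (rule realization_extensional[OF zi[OF i]])
    fix v assume v: "v \<in> \<Union>X"
    have "marginals (refine z) i v = (\<Sum>c\<in>{c\<in>\<Union>column_sets. c ! i = v}. weight z c)"
      using i v by (simp add: marginals_def) (rule sum.cong, simp_all add: refine_def)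
    also have "\<dots> = z i v"
      by (rule sum_weight_positive[OF zP i v sub Union_column_sets_subset])
    finally show "marginals (refine z) i v = z i v" .
  qed
qed

lemma marginals_in_realization:
  assumes w: "w \<in> topspace (geometric_realization column_sets)" and i: "i < n"
  shows "marginals w i \<in> topspace (geometric_realization X)"
proof -
  note nonneg = realization_nonneg[OF w]
  have "(\<Sum>v\<in>\<Union>X. marginals w i v) = (\<Sum>v\<in>\<Union>X. \<Sum>c\<in>{c\<in>\<Union>column_sets. c ! i = v}. w c)"
    using i by (intro sum.cong) (simp_all add: marginals_def)
  also have "\<dots> = 1"
    unfolding sum_by_row[OF i Union_column_sets_subset] by (rule realization_sum[OF w])
  finally have "(\<Sum>v\<in>\<Union>X. marginals w i v) = 1" .
  moreover have "0 \<le> marginals w i v" if "v \<in> \<Union>X" for v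
    using i that nonneg by (auto simp: marginals_def intro!: sum_nonneg)
  moreover have "support X (marginals w i) = (\<lambda>c. c ! i) ` support column_sets w"
  proof -
    have pos: "0 < marginals w i v \<longleftrightarrow> (\<exists>c\<in>\<Union>column_sets. c ! i = v \<and> 0 < w c)" if "v \<in> \<Union>X" for v
    proof -
      have "finite {c\<in>\<Union>column_sets. c ! i = v}" using finite_Union_column_sets by (rule rev_finite_subset) blast
      then have "(\<Sum>c\<in>{c\<in>\<Union>column_sets. c ! i = v}. w c) = 0 \<longleftrightarrow> (\<forall>c\<in>{c\<in>\<Union>column_sets. c ! i = v}. w c = 0)"
        by (rule sum_nonneg_eq_0_iff) (use nonneg in blast)
      moreover have "0 \<le> (\<Sum>c\<in>{c\<in>\<Union>column_sets. c ! i = v}. w c)"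
        by (rule sum_nonneg) (use nonneg in blast)
      moreover have "w c \<noteq> 0 \<longleftrightarrow> 0 < w c" if "c \<in> \<Union>column_sets" for c
        using nonneg[OF that] by linarith
      ultimately have "0 < (\<Sum>c\<in>{c\<in>\<Union>column_sets. c ! i = v}. w c) \<longleftrightarrow> (\<exists>c\<in>{c\<in>\<Union>column_sets. c ! i = v}. 0 < w c)"
        by (metis (mono_tags, lifting) less_le mem_Collect_eq)
      moreover have "marginals w i v = (\<Sum>c\<in>{c\<in>\<Union>column_sets. c ! i = v}. w c)"
        using i that by (simp add: marginals_def)
      moreover have "(\<exists>c\<in>{c\<in>\<Union>column_sets. c ! i = v}. 0 < w c) \<longleftrightarrow>
          (\<exists>c\<in>\<Union>column_sets. c ! i = v \<and> 0 < w c)"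
        by blast
      ultimately show ?thesis by argo
    qed
    have col: "c ! i \<in> \<Union>X" if "c \<in> \<Union>column_sets" for c
      using Union_column_sets_subset columns_nth[OF _ i] that by blast
    show ?thesis
    proof (intro set_eqI iffI)
      fix v assume "v \<in> support X (marginals w i)"
      then have "\<exists>c\<in>\<Union>column_sets. c ! i = v \<and> 0 < w c" unfolding support_iff using pos by metis
      then obtain c where "c \<in> \<Union>column_sets" "c ! i = v" "0 < w c" by (rule bexE) metis
      then show "v \<in> (\<lambda>c. c ! i) ` support column_sets w" unfolding image_iff Bex_def support_iff by metis
    next
      fix v assume "v \<in> (\<lambda>c. c ! i) ` support column_sets w"
      then obtain c where "c \<in> \<Union>column_sets" "c ! i = v" "0 < w c"
        unfolding image_iff Bex_def support_iff by metis
      then show "v \<in> support X (marginals w i)" unfolding support_iff using pos[of v] col[of c] by metis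
    qed
  qed
  moreover have "conf_columns X r n (support column_sets w)" using realization_support[OF w] by simp
  ultimately show ?thesis
    using i conf_columnsD(5)[OF _ i] by (simp add: topspace_geometric_realization) (simp add: marginals_def)
qed

text \<open>The left side is the total weight of \<open>c\<close> and of the columns with a strictly smaller entry than \<open>c\<close>
  in row \<open>k\<close>. As the support is a chain, all these columns lie below \<open>c\<close>, hence have an entry at most
  that of \<open>c\<close> in row \<open>i\<close>; and the right side is the weight of all columns with that property.\<close>
lemma overlap_ge_weight:
  assumes w: "w \<in> topspace (geometric_realization column_sets)"
    and c: "c \<in> support column_sets w" and i: "i < n" and k: "k < n"
  shows "below (marginals w k) (c ! k) + w c \<le> below (marginals w i) (c ! i) + marginals w i (c ! i)"
proof -
  let ?S = "support column_sets w"
  note nonneg = realization_nonneg[OF w]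
  have T: "conf_columns X r n ?S" using realization_support[OF w] by simp
  have fS: "finite ?S" by (rule conf_columnsD(1)[OF T])
  have S: "d \<in> \<Union>column_sets" "0 < w d" if "d \<in> ?S" for d
    using that unfolding support_def by blast+
  have col: "d ! j \<in> \<Union>X" if "d \<in> \<Union>column_sets" "j < n" for d j
    using Union_column_sets_subset columns_nth that by blast
  have rows: "(\<Sum>u\<in>A. marginals w j u) = (\<Sum>d\<in>{d\<in>?S. d ! j \<in> A}. w d)"
    if "A \<subseteq> \<Union>X" "j < n" for A j
  proof -
    have fA: "finite A" using finite_vertices that(1) by (rule rev_finite_subset)
    have fQ: "finite {d\<in>\<Union>column_sets. d ! j \<in> A}" using finite_Union_column_sets by (rule rev_finite_subset) blast
    have "(\<Sum>u\<in>A. marginals w j u) = (\<Sum>u\<in>A. \<Sum>d\<in>{d\<in>{d\<in>\<Union>column_sets. d ! j \<in> A}. d ! j = u}. w d)"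
    proof (rule sum.cong[OF refl])
      fix u assume u: "u \<in> A"
      then have "{d\<in>{d\<in>\<Union>column_sets. d ! j \<in> A}. d ! j = u} = {d\<in>\<Union>column_sets. d ! j = u}" by blast
      moreover have "u \<in> \<Union>X" using u that(1) by blast
      ultimately show "marginals w j u = (\<Sum>d\<in>{d\<in>{d\<in>\<Union>column_sets. d ! j \<in> A}. d ! j = u}. w d)"
        using that(2) by (simp add: marginals_def)
    qed
    also have "\<dots> = (\<Sum>d\<in>{d\<in>\<Union>column_sets. d ! j \<in> A}. w d)"
      by (rule sum.group[OF fQ fA]) blast
    also have "\<dots> = (\<Sum>d\<in>{d\<in>?S. d ! j \<in> A}. w d)"
    proof (rule sum.mono_neutral_right[OF fQ])
      show "{d\<in>?S. d ! j \<in> A} \<subseteq> {d\<in>\<Union>column_sets. d ! j \<in> A}" using S(1) by blast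
      show "\<forall>d\<in>{d\<in>\<Union>column_sets. d ! j \<in> A} - {d\<in>?S. d ! j \<in> A}. w d = 0"
      proof
        fix d assume d: "d \<in> {d\<in>\<Union>column_sets. d ! j \<in> A} - {d\<in>?S. d ! j \<in> A}"
        then have "d \<in> \<Union>column_sets" "\<not> 0 < w d" unfolding support_def by blast+
        then show "w d = 0" using nonneg[of d] by linarith
      qed
    qed
    finally show ?thesis .
  qed
  define D where "D = {d\<in>?S. (d ! k, c ! k) \<in> r \<and> d ! k \<noteq> c ! k}"
  define E where "E = {d\<in>?S. (d ! i, c ! i) \<in> r}"
  have fin: "finite D" "finite E" using fS by (simp_all add: D_def E_def)
  have "below (marginals w k) (c ! k) = sum w D"
  proof -
    have "{d\<in>?S. d ! k \<in> {u\<in>\<Union>X. (u, c ! k) \<in> r \<and> u \<noteq> c ! k}} = D"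
      unfolding D_def using col[OF S(1) k] by (intro set_eqI) (simp, metis)
    then show ?thesis unfolding below_def by (subst rows[OF _ k]) auto
  qed
  moreover have "below (marginals w i) (c ! i) + marginals w i (c ! i) = sum w E"
  proof -
    have "{d\<in>?S. d ! i \<in> {u\<in>\<Union>X. (u, c ! i) \<in> r}} = E"
      unfolding E_def using col[OF S(1) i] by (intro set_eqI) (simp, metis)
    then show ?thesis
      unfolding below_add[OF col[OF S(1)[OF c] i]] by (subst rows[OF _ i]) auto
  qed
  moreover have "insert c D \<subseteq> E"
  proof
    fix d assume "d \<in> insert c D"
    then consider "d = c" | "d \<in> D" by blast
    then show "d \<in> E"
    proof cases
      case 1
      then show ?thesis using c refl_order[OF col[OF S(1)[OF c] i]] by (simp add: E_def)
    next
      case 2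
      then have d: "d \<in> ?S" "(d ! k, c ! k) \<in> r" "d ! k \<noteq> c ! k" by (simp_all add: D_def)
      then have "(c ! k, d ! k) \<notin> r" using antisymD[OF antisym_order] by blast
      moreover have "c \<noteq> d" using d(3) by blast
      ultimately have "(d ! i, c ! i) \<in> r" using conf_columnsD(4)[OF T c d(1)] i k by blast
      then show ?thesis using d(1) by (simp add: E_def)
    qed
  qed
  then have "sum w (insert c D) \<le> sum w E"
    using fin(2) S(2) by (intro sum_mono2) (auto simp: E_def intro!: less_imp_le[OF S(2)])
  moreover have "c \<notin> D" by (simp add: D_def)
  ultimately show ?thesis using fin(1) by simp
qed

lemma weight_marginals_ge:
  assumes w: "w \<in> topspace (geometric_realization column_sets)" and c: "c \<in> support column_sets w"
  shows "w c \<le> weight (marginals w) c"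
proof -
  have ne: "f ` {..<n} \<noteq> {}" for f :: "nat \<Rightarrow> real" using n_pos by (auto simp: lessThan_empty_iff)
  let ?lo = "\<lambda>i. below (marginals w i) (c ! i)" and ?up = "\<lambda>i. below (marginals w i) (c ! i) + marginals w i (c ! i)"
  have "Min (?up ` {..<n}) \<in> ?up ` {..<n}" "Max (?lo ` {..<n}) \<in> ?lo ` {..<n}"
    using ne by (intro Min_in Max_in; simp)+
  then obtain i k where ik: "i < n" "k < n" "Min (?up ` {..<n}) = ?up i" "Max (?lo ` {..<n}) = ?lo k"
    by auto
  then show ?thesis unfolding weight_eq ik(3,4) using overlap_ge_weight[OF w c ik(1,2)] by simp
qed

text \<open>If two marginals agreed, take a column \<open>c\<close> of the support with different entries in the two rows. Its
  common cell has positive length but lies in the cells of two vertices of one partition.\<close>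
lemma marginals_in_Conf:
  assumes w: "w \<in> topspace (geometric_realization column_sets)"
  shows "marginals w \<in> topspace (Conf n (geometric_realization X))"
proof -
  let ?S = "support column_sets w"
  have T: "conf_columns X r n ?S" using realization_support[OF w] by simp
  have "i = k" if ik: "i < n" "k < n" and eq: "marginals w i = marginals w k" for i k
  proof (rule ccontr)
    assume "i \<noteq> k"
    then obtain c where c: "c \<in> ?S" "c ! i \<noteq> c ! k" using conf_columnsD(6)[OF T ik] by blast
    have "0 < w c" and cQ: "c \<in> \<Union>column_sets" using c(1) unfolding support_def by blast+
    then have "0 < weight (marginals w) c" using weight_marginals_ge[OF w c(1)] by linarith
    then obtain t where t: "t \<in> common_cell (marginals w) c" using weight_pos_common_cell by blast
    have cc: "c \<in> columns" using cQ Union_column_sets_subset by blast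
    have "c ! i = c ! k"
    proof (rule cell_unique)
      show "marginals w i \<in> topspace (geometric_realization X)" by (rule marginals_in_realization[OF w ik(1)])
      show "t \<in> cell (marginals w i) (c ! i)" by (rule common_cellD[OF t ik(1)])
      show "t \<in> cell (marginals w i) (c ! k)" unfolding eq by (rule common_cellD[OF t ik(2)])
    qed (rule columns_nth[OF cc], rule ik)+
    with c(2) show False ..
  qed
  then have "inj_on (marginals w) {..<n}" by (auto intro: inj_onI)
  moreover have "marginals w \<in> extensional {..<n}" by (simp add: marginals_def)
  ultimately show ?thesis using marginals_in_realization[OF w] by (simp add: topspace_Conf)
qed

text \<open>The weights of the common cells dominate \<open>w\<close>, and both have total 1.\<close>
lemma refine_marginals:
  assumes w: "w \<in> topspace (geometric_realization column_sets)"
  shows "refine (marginals w) = w"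
proof (rule extensionalityI[of _ "\<Union>column_sets"])
  show "refine (marginals w) \<in> extensional (\<Union>column_sets)" by (simp add: refine_def)
  show "w \<in> extensional (\<Union>column_sets)" by (rule realization_extensional[OF w])
  fix c assume c: "c \<in> \<Union>column_sets"
  have R: "refine (marginals w) \<in> topspace (geometric_realization column_sets)"
    by (rule refine_in_realization[OF marginals_in_Conf[OF w]])
  have le: "w d \<le> refine (marginals w) d" if d: "d \<in> \<Union>column_sets" for d
  proof (cases "0 < w d")
    case True
    then have "d \<in> support column_sets w" using d unfolding support_def by blast
    then show ?thesis using weight_marginals_ge[OF w] d by (simp add: refine_def)
  next
    case False
    then show ?thesis using realization_nonneg[OF R d] by linarith
  qed
  have "sum w (\<Union>column_sets) = sum (refine (marginals w)) (\<Union>column_sets)"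
    unfolding realization_sum[OF w] realization_sum[OF R] ..
  then have "w c = refine (marginals w) c"
    by (rule sum_mono_inv) (fact le, fact c, fact finite_Union_column_sets)
  then show "refine (marginals w) c = w c" ..
qed

lemma continuous_map_refine:
  "continuous_map (Conf n (geometric_realization X)) (geometric_realization column_sets) refine"
proof (rule continuous_map_into_realization)
  let ?C = "Conf n (geometric_realization X)"
  fix c assume c: "c \<in> \<Union>column_sets"
  then have cc: "c \<in> columns" using Union_column_sets_subset by blast
  have coord: "continuous_map ?C euclideanreal (\<lambda>z. z i v)" if "i < n" "v \<in> \<Union>X" for i v
    using continuous_map_compose[OF continuous_map_Conf_coordinate[OF that(1)] continuous_map_realization_coordinate[OF that(2)]]
    by (simp add: o_def)
  have low: "continuous_map ?C euclideanreal (\<lambda>z. below (z i) v)" if "i < n" for i v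
    unfolding below_def using finite_vertices
    by (intro continuous_map_sum) (auto intro!: coord[OF that])
  have ne: "{..<n} \<noteq> {}" using n_pos by (auto simp: lessThan_empty_iff)
  have "continuous_map ?C euclideanreal (\<lambda>z. weight z c)"
    unfolding weight_eq using ne
    by (intro continuous_map_real_max continuous_map_diff continuous_map_Min continuous_map_Max
        continuous_map_add low coord columns_nth[OF cc]) auto
  then show "continuous_map ?C euclideanreal (\<lambda>z. refine z c)" using c by (simp add: refine_def)
qed (rule refine_in_realization)

lemma continuous_map_marginals:
  "continuous_map (geometric_realization column_sets) (Conf n (geometric_realization X)) marginals"
proof (rule continuous_map_into_Conf)
  fix i assume i: "i < n"
  show "continuous_map (geometric_realization column_sets) (geometric_realization X) (\<lambda>w. marginals w i)"
  proof (rule continuous_map_into_realization)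
    fix v assume v: "v \<in> \<Union>X"
    have "continuous_map (geometric_realization column_sets) euclideanreal
            (\<lambda>w. \<Sum>c\<in>{c\<in>\<Union>column_sets. c ! i = v}. w c)"
    proof (rule continuous_map_sum)
      show "finite {c\<in>\<Union>column_sets. c ! i = v}" using finite_Union_column_sets by (rule rev_finite_subset) blast
    qed (rule continuous_map_realization_coordinate, blast)
    then show "continuous_map (geometric_realization column_sets) euclideanreal (\<lambda>w. marginals w i v)"
      using i v by (simp add: marginals_def)
  qed (rule marginals_in_realization[OF _ i])
qed (rule marginals_in_Conf)

theorem realization_column_sets_homeomorphic_Conf:
  "geometric_realization column_sets homeomorphic_space Conf n (geometric_realization X)"
  unfolding homeomorphic_space_def homeomorphic_maps_def
  using continuous_map_marginals continuous_map_refine refine_marginals marginals_refine by blast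

section \<open>The complex of minimal conf matrices as a nerve\<close>

lemma finite_minimal_conf_matrices: "finite {M. minimal_conf_matrix X r n M}"
proof -
  have "finite (conf_complex n X r)"
    by (rule finite_conf_complex[OF complex finite_complex n_pos])
  moreover have "finite S" if "S \<in> conf_complex n X r" for S using that by (simp add: conf_complex_def)
  ultimately show ?thesis
    unfolding Union_conf_complex[symmetric] by blast
qed

lemma conf_complex_eq_subset_nerve:
  "conf_complex n X r =
     subset_nerve {M. minimal_conf_matrix X r n M} (\<lambda>M. set (List.transpose M)) column_sets"
proof -
  have "(\<exists>A. conf_matrix X r n A \<and> set (List.transpose A) = T) \<longleftrightarrow> conf_columns X r n T" for T
    using conf_columns_transpose[OF _ n_pos] conf_matrix_of_columns[OF _ n_pos trans_order] by metis
  moreover have "finite S" if "S \<subseteq> {M. minimal_conf_matrix X r n M}" for S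
    using finite_minimal_conf_matrices that by (rule rev_finite_subset)
  ultimately show ?thesis
    unfolding conf_complex_def subset_nerve_def by (auto 0 3)
qed

lemma realization_conf_complex_homotopy_equivalent:
  "geometric_realization (conf_complex n X r) homotopy_equivalent_space geometric_realization column_sets"
  unfolding conf_complex_eq_subset_nerve
proof (rule subset_nerve_homotopy_equivalent)
  show "finite {M. minimal_conf_matrix X r n M}" by (rule finite_minimal_conf_matrices)
  show "finite (\<Union>column_sets)" by (rule finite_Union_column_sets)
  show "{} \<notin> column_sets" by (simp add: conf_columns_def)
  show "set (List.transpose M) \<in> column_sets" if "M \<in> {M. minimal_conf_matrix X r n M}" for M
    using that conf_columns_transpose[OF _ n_pos] unfolding minimal_conf_matrix_def by blast
  show "\<exists>M\<in>{M. minimal_conf_matrix X r n M}. set (List.transpose M) \<subseteq> T" if "T \<in> column_sets" for T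
    using minimal_conf_matrix_below[OF complex _ n_pos trans_order, of T] that by blast
  show "B \<in> column_sets" if "A \<in> column_sets" "D \<in> column_sets" "A \<subseteq> B" "B \<subseteq> D" for A B D
    using conf_columns_convex[OF complex _ _ that(3,4)] that(1,2) by blast
qed

end

theorem theorem1p3:
  fixes X :: "'v set set" and r :: "'v rel" and n :: nat
  assumes "abstract_simplicial_complex X" and "finite X"
    and "facewise_linear_order X r"
    and "1 \<le> n"
  shows "geometric_realization (conf_complex n X r)
         homotopy_equivalent_space
         Conf n (geometric_realization X)"
proof -
  interpret ordered_complex X r n by unfold_locales (fact assms)+
  show ?thesis
    using realization_conf_complex_homotopy_equivalent
      homeomorphic_imp_homotopy_equivalent_space[OF realization_column_sets_homeomorphic_Conf]
    by (rule homotopy_eqv_trans)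
qed
end
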